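(* Let $F$ be an algebraically closed field, let $(a_n)_{n=2}^{\infty}$ be a sequence of non-negative integers with support $\mathcal{S}=\{n\ge 2 : a_n\neq 0\}$, and let $B=F\langle e,\sigma\rangle$ be the finitely generated $F$-algebra associated with $(a_n)$ as defined in the context. Then, for every $n\in\mathcal{S}$, $B$ has precisely $a_n$ non-isomorphic simple modules of dimension $n$ over $F$, and $B$ has no simple modules of dimension $n$ for any integer $n>1$ with $n\notin\mathcal{S}$.
   Context: For every $n\in\mathcal{S}$ let $A_n=\prod_{i=1}^{a_n}M_n(F)$, i.e. the direct product of $a_n$ copies of the ring of $n\times n$ matrices over $F$. Choose non-zero elements $\lambda_{n,i}\in F$ ($n\in\mathcal{S}$, $1\le i\le a_n$) that are all distinct, and such that for each fixed $n$ they are distinct even up to sign (i.e. $\lambda_{n,i}\neq\pm\lambda_{n,j}$ for $i\neq j$). Let $e_n\in A_n$ be the element whose $i$-th component is the matrix with upper-left entry $\lambda_{n,i}$ and all other entries zero. Let $\sigma_n\in A_n$ be the element all of whose components equal the $n\times n$ matrix $\left(\begin{array}{cc}0 & I_{n-1}\\ 1 & 0\end{array}\right)$, where $I_{n-1}$ is the identity matrix of size $(n-1)\times(n-1)$. Let $A=\prod_{n\in\mathcal{S}}A_n$ with natural projections $\pi_n:A\to A_n$, and let $e,\sigma\in A$ be the elements with $\pi_n(e)=e_n$ and $\pi_n(\sigma)=\sigma_n$ for all $n\in\mathcal{S}$. Finally, $B=F\langle e,\sigma\rangle$ is the unital $F$-subalgebra of $A$ generated by $e$ and $\sigma$ ($F$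 being embedded diagonally in $A$). Modules are unital left modules, dimension means dimension over $F$, and modules are counted up to isomorphism. *)

theory Defs
  imports "Jordan_Normal_Form.VS_Connect" "HOL-Algebra.Generated_Rings"
begin

section \<open>Direct products of rings\<close>

text \<open>Elements are extensional functions on the index set, as for \<open>product_group\<close>.\<close>

definition product_ring :: "'i set \<Rightarrow> ('i \<Rightarrow> ('r, 'm) ring_scheme) \<Rightarrow> ('i \<Rightarrow> 'r) ring" where
  "product_ring I R =
     \<lparr>carrier = (\<Pi>\<^sub>E i\<in>I. carrier (R i)),
      mult = (\<lambda>x y. \<lambda>i\<in>I. x i \<otimes>\<^bsub>R i\<^esub> y i),
      one = (\<lambda>i\<in>I. \<one>\<^bsub>R i\<^esub>),
      zero = (\<lambda>i\<in>I. \<zero>\<^bsub>R i\<^esub>),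
      add = (\<lambda>x y. \<lambda>i\<in>I. x i \<oplus>\<^bsub>R i\<^esub> y i)\<rparr>"

lemma product_ring_simps:
  "carrier (product_ring I R) = (\<Pi>\<^sub>E i\<in>I. carrier (R i))"
  "x \<otimes>\<^bsub>product_ring I R\<^esub> y = (\<lambda>i\<in>I. x i \<otimes>\<^bsub>R i\<^esub> y i)"
  "\<one>\<^bsub>product_ring I R\<^esub> = (\<lambda>i\<in>I. \<one>\<^bsub>R i\<^esub>)"
  "\<zero>\<^bsub>product_ring I R\<^esub> = (\<lambda>i\<in>I. \<zero>\<^bsub>R i\<^esub>)"
  "x \<oplus>\<^bsub>product_ring I R\<^esub> y = (\<lambda>i\<in>I. x i \<oplus>\<^bsub>R i\<^esub> y i)"
  by (simp_all add: product_ring_def)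

lemma ring_product_ring:
  assumes R: "\<And>i. i \<in> I \<Longrightarrow> ring (R i)"
  shows "ring (product_ring I R)"
proof (rule ringI)
  show "abelian_group (product_ring I R)"
  proof (rule abelian_groupI)
    fix x assume x: "x \<in> carrier (product_ring I R)"
    show "\<exists>y\<in>carrier (product_ring I R). y \<oplus>\<^bsub>product_ring I R\<^esub> x = \<zero>\<^bsub>product_ring I R\<^esub>"
    proof
      show "(\<lambda>i\<in>I. \<ominus>\<^bsub>R i\<^esub> x i) \<in> carrier (product_ring I R)"
        using x R by (auto simp: product_ring_simps PiE_iff ring.ring_simprules)
      show "(\<lambda>i\<in>I. \<ominus>\<^bsub>R i\<^esub> x i) \<oplus>\<^bsub>product_ring I R\<^esub> x = \<zero>\<^bsub>product_ring I R\<^esub>"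
        using x R by (auto simp: product_ring_simps PiE_iff ring.ring_simprules intro!: restrict_ext)
    qed
  qed (use R in \<open>auto simp: product_ring_simps PiE_iff ring.ring_simprules
         intro!: restrict_ext extensionalityI[of _ I]\<close>)
  show "monoid (product_ring I R)"
    by (rule monoidI)
      (use R in \<open>auto simp: product_ring_simps PiE_iff ring.ring_simprules
         monoid.r_one[OF ring.is_monoid] intro!: restrict_ext extensionalityI[of _ I]\<close>)
qed (use R in \<open>auto simp: product_ring_simps PiE_iff ring_def abelian_group.axioms
         abelian_monoid.a_closed monoid.m_closed ring_axioms_def intro!: restrict_ext\<close>)


section \<open>Left modules over a not necessarily commutative ring\<close>

text \<open>The library locale \<open>module\<close> requires a commutative ring of scalars; otherwise the axioms
  below are the same. The fields \<open>mult\<close> and \<open>one\<close> of the record type \<open>module\<close> play no role.\<close>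

locale left_module = R?: ring R + M?: abelian_group M
    for R :: "('r, 'k) ring_scheme" (structure) and M :: "('r, 'v, 'l) module_scheme" (structure) +
  assumes smult_closed:
      "\<lbrakk>a \<in> carrier R; x \<in> carrier M\<rbrakk> \<Longrightarrow> a \<odot>\<^bsub>M\<^esub> x \<in> carrier M"
    and smult_l_distr:
      "\<lbrakk>a \<in> carrier R; b \<in> carrier R; x \<in> carrier M\<rbrakk> \<Longrightarrow>
        (a \<oplus>\<^bsub>R\<^esub> b) \<odot>\<^bsub>M\<^esub> x = a \<odot>\<^bsub>M\<^esub> x \<oplus>\<^bsub>M\<^esub> b \<odot>\<^bsub>M\<^esub> x"
    and smult_r_distr:
      "\<lbrakk>a \<in> carrier R; x \<in> carrier M; y \<in> carrier M\<rbrakk> \<Longrightarrow>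
        a \<odot>\<^bsub>M\<^esub> (x \<oplus>\<^bsub>M\<^esub> y) = a \<odot>\<^bsub>M\<^esub> x \<oplus>\<^bsub>M\<^esub> a \<odot>\<^bsub>M\<^esub> y"
    and smult_assoc:
      "\<lbrakk>a \<in> carrier R; b \<in> carrier R; x \<in> carrier M\<rbrakk> \<Longrightarrow>
        (a \<otimes>\<^bsub>R\<^esub> b) \<odot>\<^bsub>M\<^esub> x = a \<odot>\<^bsub>M\<^esub> (b \<odot>\<^bsub>M\<^esub> x)"
    and smult_one:
      "x \<in> carrier M \<Longrightarrow> \<one>\<^bsub>R\<^esub> \<odot>\<^bsub>M\<^esub> x = x"

text \<open>The qualified name selects the HOL-Algebra notion, which, unlike the one of the
  VectorSpace entry, does not assume commutative scalars.\<close>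

definition simple_module :: "('r, 'k) ring_scheme \<Rightarrow> ('r, 'v, 'l) module_scheme \<Rightarrow> bool" where
  "simple_module R M \<longleftrightarrow>
     left_module R M \<and> carrier M \<noteq> {\<zero>\<^bsub>M\<^esub>} \<and>
     (\<forall>N. Module.submodule N R M \<longrightarrow> N = {\<zero>\<^bsub>M\<^esub>} \<or> N = carrier M)"

definition module_isomorphic ::
  "('r, 'k) ring_scheme \<Rightarrow> ('r, 'v, 'l) module_scheme \<Rightarrow> ('r, 'w, 'm) module_scheme \<Rightarrow> bool" where
  "module_isomorphic R M N \<longleftrightarrow> (\<exists>f\<in>LinearCombinations.module_hom R M N. bij_betw f (carrier M) (carrier N))"

definition restrict_scalars :: "('s \<Rightarrow> 'r) \<Rightarrow> ('r, 'v) module \<Rightarrow> ('s, 'v) module" where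
  "restrict_scalars h M =
     \<lparr>carrier = carrier M, mult = mult M, one = one M, zero = zero M, add = add M,
      smult = (\<lambda>c x. h c \<odot>\<^bsub>M\<^esub> x)\<rparr>"


section \<open>The algebra \<open>B\<close>\<close>

definition supp :: "(nat \<Rightarrow> nat) \<Rightarrow> nat set" where
  "supp a = {n. n \<ge> 2 \<and> a n \<noteq> 0}"

definition A_ring :: "(nat \<Rightarrow> nat) \<Rightarrow> (nat \<Rightarrow> nat \<Rightarrow> 'a::field mat) ring" where
  "A_ring a = product_ring (supp a) (\<lambda>n. product_ring {1..a n} (\<lambda>i. ring_mat TYPE('a) n ()))"

definition e_elem :: "(nat \<Rightarrow> nat) \<Rightarrow> (nat \<Rightarrow> nat \<Rightarrow> 'a) \<Rightarrow> nat \<Rightarrow> nat \<Rightarrow> 'a::field mat" where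
  "e_elem a lam = (\<lambda>n\<in>supp a. \<lambda>i\<in>{1..a n}.
     mat n n (\<lambda>(r, s). if r = 0 \<and> s = 0 then lam n i else 0))"

definition sigma_elem :: "(nat \<Rightarrow> nat) \<Rightarrow> nat \<Rightarrow> nat \<Rightarrow> 'a::field mat" where
  "sigma_elem a = (\<lambda>n\<in>supp a. \<lambda>i\<in>{1..a n}.
     four_block_mat (0\<^sub>m (n - 1) 1) (1\<^sub>m (n - 1)) (1\<^sub>m 1) (0\<^sub>m 1 (n - 1)))"

text \<open>The diagonal embedding of the ground field.\<close>

definition diag_elem :: "(nat \<Rightarrow> nat) \<Rightarrow> 'a \<Rightarrow> nat \<Rightarrow> nat \<Rightarrow> 'a::field mat" where
  "diag_elem a c = (\<lambda>n\<in>supp a. \<lambda>i\<in>{1..a n}. c \<cdot>\<^sub>m 1\<^sub>m n)"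

text \<open>The unital subalgebra generated by a set is the unital subring generated by that set
  together with the scalars.\<close>

definition B_ring ::
  "(nat \<Rightarrow> nat) \<Rightarrow> (nat \<Rightarrow> nat \<Rightarrow> 'a) \<Rightarrow> (nat \<Rightarrow> nat \<Rightarrow> 'a::field mat) ring" where
  "B_ring a lam =
     (A_ring a)\<lparr>carrier :=
        generate_ring (A_ring a) (range (diag_elem a) \<union> {e_elem a lam, sigma_elem a})\<rparr>"

lemma ring_A_ring: "ring (A_ring a)"
  unfolding A_ring_def by (intro ring_product_ring ring_mat)

lemma generators_in_A_ring:
  "range (diag_elem a) \<union> {e_elem a lam, sigma_elem a} \<subseteq> carrier (A_ring a)"
proof -
  have "four_block_mat (0\<^sub>m (n - 1) 1) (1\<^sub>m (n - 1)) (1\<^sub>m 1) (0\<^sub>m 1 (n - 1))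
        \<in> carrier_mat n n" if "n \<in> supp a" for n
    using that by (auto simp: supp_def intro!: carrier_matI)
  then show ?thesis
    by (auto simp: A_ring_def product_ring_simps ring_mat_simps
        e_elem_def sigma_elem_def diag_elem_def PiE_iff)
qed

lemma ring_B_ring: "ring (B_ring a lam)"
  unfolding B_ring_def
  by (rule ring.generate_ring_is_ring[OF ring_A_ring generators_in_A_ring])

text \<open>The dimension over the ground field, which acts on a \<open>B\<close>-module through the diagonal
  embedding. The finiteness condition is needed because \<open>vectorspace.dim\<close> is an arbitrary
  number on infinite-dimensional spaces.\<close>

definition has_dimension ::
  "(nat \<Rightarrow> nat) \<Rightarrow> (nat \<Rightarrow> nat \<Rightarrow> 'a::field mat, 'v) module \<Rightarrow> nat \<Rightarrow> bool" where
  "has_dimension a M d \<longleftrightarrow>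
     (let V = restrict_scalars (diag_elem a) M
      in vectorspace.fin_dim (class_ring :: 'a ring) V \<and>
         vectorspace.dim (class_ring :: 'a ring) V = d)"

end

theory Submission
  imports Defs
begin

text \<open>
  The algebra \<open>B\<close> contains each of its matrix factors as an ideal. Indeed \<open>e \<sigma>\<^sup>n e\<close> is nonzero exactly
  in the factors whose size divides \<open>n\<close>. For \<open>n > 0\<close> these are finitely many, with distinct nonzero
  weights, so a polynomial in \<open>e\<close> isolates the corner of a single factor of size \<open>n\<close>
  (\<open>single_corner_B\<close>), and shifting by powers of \<open>\<sigma>\<close> gives all matrices there (\<open>single_B\<close>).
  Therefore the column vectors of each factor form a simple module, and distinct factors give
  modules with different annihilators.

  Conversely, let \<open>N\<close> be a simple module of finite dimension. If some factor acts nontrivially, \<open>N\<close>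
  is isomorphic to the column module of that factor, by Schur's lemma
  (\<open>simple_module_isomorphic_column_module\<close>). If all factors act trivially, then so does
  \<open>e \<sigma>\<^sup>k e\<close> for every \<open>k > 0\<close>, because it is a finite sum of elements of factors. These
  relations make \<open>{v. e \<sigma>\<^sup>k v = 0 for all k}\<close> a submodule, so that by simplicity either \<open>e = 0\<close> or
  \<open>\<sigma> e = 0\<close> on \<open>N\<close>, and in the second case \<open>{v. \<sigma> v = 0}\<close> is a submodule containing \<open>e N\<close>; hence \<open>e\<close>
  or \<open>\<sigma>\<close> acts as zero (\<open>e_or_sigma_acts_trivially\<close>). An eigenvector of the other one, which exists
  over an algebraically closed field, then spans \<open>N\<close>.
  So the simple modules of dimension greater than one are exactly the column modules, with \<open>a n\<close> of
  them in dimension \<open>n\<close>.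
\<close>

section \<open>Eigenvectors of operators over an algebraically closed field\<close>

text \<open>The vector \<open>p(T) v\<close>, evaluated by Horner's scheme so that induction over polynomials applies.\<close>

definition poly_act :: "('a::field, 'v, 'm) module_scheme \<Rightarrow> ('v \<Rightarrow> 'v) \<Rightarrow> 'a poly \<Rightarrow> 'v \<Rightarrow> 'v" where
  "poly_act V T p v = fold_coeffs (\<lambda>c w. c \<odot>\<^bsub>V\<^esub> v \<oplus>\<^bsub>V\<^esub> T w) p \<zero>\<^bsub>V\<^esub>"

locale linear_operator = vectorspace class_ring V
  for V :: "('a::field, 'v, 'm) module_scheme" +
  fixes T :: "'v \<Rightarrow> 'v"
  assumes T_closed [simp]: "x \<in> carrier V \<Longrightarrow> T x \<in> carrier V"
    and T_add: "x \<in> carrier V \<Longrightarrow> y \<in> carrier V \<Longrightarrow> T (x \<oplus>\<^bsub>V\<^esub> y) = T x \<oplus>\<^bsub>V\<^esub> T y"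
    and T_smult: "x \<in> carrier V \<Longrightarrow> T (c \<odot>\<^bsub>V\<^esub> x) = c \<odot>\<^bsub>V\<^esub> T x"
begin

lemma T_zero [simp]: "T \<zero>\<^bsub>V\<^esub> = \<zero>\<^bsub>V\<^esub>"
  using T_smult[of "\<zero>\<^bsub>V\<^esub>" 0] lmult_0[of "T \<zero>\<^bsub>V\<^esub>"] lmult_0[of "\<zero>\<^bsub>V\<^esub>"] by simp

lemma scalar_closed [simp]: "x \<in> carrier V \<Longrightarrow> c \<odot>\<^bsub>V\<^esub> x \<in> carrier V"
  by (rule smult_closed) simp_all

lemma scalar_zero [simp]: "x \<in> carrier V \<Longrightarrow> 0 \<odot>\<^bsub>V\<^esub> x = \<zero>\<^bsub>V\<^esub>"
  using lmult_0[of x] by simp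

lemma poly_act_0 [simp]: "poly_act V T 0 v = \<zero>\<^bsub>V\<^esub>"
  by (simp add: poly_act_def)

lemma poly_act_pCons [simp]:
  assumes "v \<in> carrier V"
  shows "poly_act V T (pCons c p) v = c \<odot>\<^bsub>V\<^esub> v \<oplus>\<^bsub>V\<^esub> T (poly_act V T p v)"
proof (cases "c = 0 \<and> p = 0")
  case True
  then show ?thesis using assms by simp
next
  case False
  then show ?thesis
    by (cases "c = 0") (simp_all add: poly_act_def fold_coeffs_pCons_not_0_0_eq
        fold_coeffs_pCons_coeff_not_0_eq)
qed

lemma poly_act_closed [simp]:
  assumes v: "v \<in> carrier V"
  shows "poly_act V T p v \<in> carrier V"
  by (induct p) (use v in auto)

lemma poly_act_add:
  assumes v: "v \<in> carrier V"
  shows "poly_act V T (p + q) v = poly_act V T p v \<oplus>\<^bsub>V\<^esub> poly_act V T q v"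
proof (induct p q rule: poly_induct2)
  case 0
  show ?case by simp
next
  case (pCons c p d q)
  have "(c + d) \<odot>\<^bsub>V\<^esub> v = c \<odot>\<^bsub>V\<^esub> v \<oplus>\<^bsub>V\<^esub> d \<odot>\<^bsub>V\<^esub> v"
    using smult_l_distr[of c d v] v by simp
  then show ?case using pCons v by (simp add: T_add M.add.m_ac)
qed

lemma poly_act_smult:
  assumes v: "v \<in> carrier V"
  shows "poly_act V T (Polynomial.smult c p) v = c \<odot>\<^bsub>V\<^esub> poly_act V T p v"
proof (induct p)
  case 0
  show ?case using smult_r_null[of c] by simp
next
  case (pCons d p)
  show ?case
    using pCons v smult_assoc1[of c d v]
      smult_r_distr[of c "d \<odot>\<^bsub>V\<^esub> v" "T (poly_act V T p v)"]
    by (simp add: T_smult)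
qed

lemma poly_act_monom:
  assumes v: "v \<in> carrier V"
  shows "poly_act V T (Polynomial.monom c i) v = c \<odot>\<^bsub>V\<^esub> (T ^^ i) v"
proof (induct i)
  case (Suc i)
  have "(T ^^ i) v \<in> carrier V" by (induct i) (use v in auto)
  then show ?case using Suc v by (simp add: monom_Suc T_smult)
qed (use v in \<open>simp add: monom_0\<close>)

text \<open>Split off a root \<open>c\<close>, so that \<open>p = (X - c) q\<close>. Either \<open>q(T) v\<close> is nonzero, and it is an
  eigenvector for \<open>c\<close>, or \<open>q\<close> is an annihilating polynomial of smaller degree.\<close>

lemma eigenvector_of_annihilating_poly:
  assumes alg: "\<And>p :: 'a poly. degree p > 0 \<Longrightarrow> \<exists>c. poly p c = 0"
    and v: "v \<in> carrier V" "v \<noteq> \<zero>\<^bsub>V\<^esub>"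
    and p: "p \<noteq> 0" "poly_act V T p v = \<zero>\<^bsub>V\<^esub>"
  shows "\<exists>u\<in>carrier V. u \<noteq> \<zero>\<^bsub>V\<^esub> \<and> (\<exists>c. T u = c \<odot>\<^bsub>V\<^esub> u)"
  using p
proof (induct "degree p" arbitrary: p)
  case 0
  then obtain c where c: "p = [:c:]" "c \<noteq> 0" by (metis degree_0_id pCons_0_0)
  have "c \<odot>\<^bsub>V\<^esub> v = \<zero>\<^bsub>V\<^esub>" using 0 c v by simp
  then have "inverse c \<odot>\<^bsub>V\<^esub> (c \<odot>\<^bsub>V\<^esub> v) = \<zero>\<^bsub>V\<^esub>" using smult_r_null[of "inverse c"] by simp
  then show ?case using smult_assoc1[of "inverse c" c v] smult_one[of v] v c by simp
next
  case (Suc n)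
  obtain c where "poly p c = 0" using alg[of p] Suc.hyps(2) by auto
  then obtain q where q: "p = [:- c, 1:] * q" by (auto simp: poly_eq_0_iff_dvd)
  have q0: "q \<noteq> 0" using q Suc.prems by auto
  have deg: "n = degree q" using Suc.hyps(2) q0 degree_mult_eq[of "[:- c, 1:]" q] by (simp only: q) simp
  let ?u = "poly_act V T q v"
  show ?case
  proof (cases "?u = \<zero>\<^bsub>V\<^esub>")
    case True
    then show ?thesis using Suc.hyps(1)[OF deg q0] by blast
  next
    case False
    have "p = Polynomial.smult (- c) q + pCons 0 q" using q by simp
    then have "poly_act V T (Polynomial.smult (- c) q + pCons 0 q) v = \<zero>\<^bsub>V\<^esub>"
      using Suc.prems(2) by (simp only:)
    then have "(- c) \<odot>\<^bsub>V\<^esub> ?u \<oplus>\<^bsub>V\<^esub> T ?u = \<zero>\<^bsub>V\<^esub>"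
      using v by (simp only: poly_act_add[OF v(1)] poly_act_smult[OF v(1)]) simp
    moreover have "(- c) \<odot>\<^bsub>V\<^esub> ?u = \<ominus>\<^bsub>V\<^esub> (c \<odot>\<^bsub>V\<^esub> ?u)"
      using smult_l_minus[of c ?u] v by (simp add: class_ring_simps)
    ultimately have "T ?u = c \<odot>\<^bsub>V\<^esub> ?u"
      using v M.r_neg1[of "c \<odot>\<^bsub>V\<^esub> ?u" "T ?u"] M.r_neg2[of "c \<odot>\<^bsub>V\<^esub> ?u" "T ?u"] by simp
    then show ?thesis using False v by auto
  qed
qed

text \<open>The \<open>dim + 1\<close> vectors \<open>v, T v, \<dots>, T\<^sup>d v\<close> with \<open>d = dim\<close> cannot be distinct and independent. If two of
  them coincide, the difference of two monomials annihilates \<open>v\<close>; this case is separate because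
  linear dependence is a property of sets, which do not see repetitions.\<close>

lemma exists_annihilating_poly:
  assumes fin: fin_dim and v: "v \<in> carrier V"
  shows "\<exists>p. p \<noteq> 0 \<and> poly_act V T p v = \<zero>\<^bsub>V\<^esub>"
proof -
  let ?f = "\<lambda>i. (T ^^ i) v"
  have f: "?f i \<in> carrier V" for i by (induct i) (use v in auto)
  show ?thesis
  proof (cases "inj_on ?f {..dim}")
    case True
    let ?A = "?f ` {..dim}"
    have A: "?A \<subseteq> carrier V" using f by (rule image_subsetI)
    have "lin_dep ?A"
    proof (rule ccontr)
      assume "\<not> lin_dep ?A"
      then have "card ?A \<le> dim" by (rule li_le_dim(2)[OF fin A])
      then show False using True by (simp add: card_image)
    qed
    then obtain b w where b: "lincomb b ?A = \<zero>\<^bsub>V\<^esub>" and w: "w \<in> ?A" "b w \<noteq> 0"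
      using finite_lin_dep[of ?A] A by auto
    have sum: "poly_act V T (\<Sum>i\<in>I. Polynomial.monom (b (?f i)) i) v = (\<Oplus>\<^bsub>V\<^esub>i\<in>I. b (?f i) \<odot>\<^bsub>V\<^esub> ?f i)"
      if "finite I" for I
      using that
    proof (induct I)
      case (insert i I)
      then show ?case using f v
        by (subst M.finsum_insert) (auto simp: poly_act_add poly_act_monom)
    qed simp
    have "(\<Oplus>\<^bsub>V\<^esub>i\<in>{..dim}. b (?f i) \<odot>\<^bsub>V\<^esub> ?f i) = lincomb b ?A"
      unfolding lincomb_def using f True by (subst M.finsum_reindex) auto
    then have "poly_act V T (\<Sum>i\<le>dim. Polynomial.monom (b (?f i)) i) v = \<zero>\<^bsub>V\<^esub>"
      using sum[of "{..dim}"] b by simp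
    moreover
    obtain j where j: "j \<le> dim" "w = ?f j" using w by auto
    have "Polynomial.coeff (\<Sum>i\<le>dim. Polynomial.monom (b (?f i)) i) j \<noteq> 0"
      unfolding Polynomial.coeff_sum Polynomial.coeff_monom using j w by simp
    then have "(\<Sum>i\<le>dim. Polynomial.monom (b (?f i)) i) \<noteq> 0"
      using Polynomial.coeff_0[of j] by fastforce
    ultimately show ?thesis by blast
  next
    case False
    then obtain i j where ij: "i \<noteq> j" "?f i = ?f j" by (auto simp: inj_on_def)
    let ?p = "Polynomial.monom 1 i + Polynomial.smult (- 1) (Polynomial.monom 1 j) :: 'a poly"
    have "Polynomial.coeff ?p i \<noteq> 0" using ij by simp
    then have "?p \<noteq> 0" by (rule contrapos_nn) (simp only: Polynomial.coeff_0)
    moreover have "(- 1) \<odot>\<^bsub>V\<^esub> ?f j = \<ominus>\<^bsub>V\<^esub> ?f j"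
      using smult_l_minus[of 1 "?f j"] smult_one[of "?f j"] f[of j] by (simp add: class_ring_simps)
    then have "poly_act V T ?p v = \<zero>\<^bsub>V\<^esub>"
      using v f ij smult_one[of "?f j"] f[of j]
      by (simp only: poly_act_add poly_act_smult poly_act_monom) (simp add: M.r_neg)
    ultimately show ?thesis by blast
  qed
qed

end

lemma eigenvector_exists:
  fixes V :: "('a::alg_closed_field, 'v, 'm) module_scheme"
  assumes "linear_operator V T" and "vectorspace.fin_dim (class_ring :: 'a ring) V"
    and "carrier V \<noteq> {\<zero>\<^bsub>V\<^esub>}"
  shows "\<exists>u\<in>carrier V. u \<noteq> \<zero>\<^bsub>V\<^esub> \<and> (\<exists>c. T u = c \<odot>\<^bsub>V\<^esub> u)"
proof -
  interpret linear_operator V T by fact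
  obtain v where v: "v \<in> carrier V" "v \<noteq> \<zero>\<^bsub>V\<^esub>" using assms(3) M.zero_closed by blast
  obtain p where "p \<noteq> 0" "poly_act V T p v = \<zero>\<^bsub>V\<^esub>"
    using exists_annihilating_poly[OF assms(2) v(1)] by blast
  then show ?thesis
    using eigenvector_of_annihilating_poly[OF alg_closed_imp_poly_has_root v] by blast
qed


section \<open>Simple modules and their homomorphisms\<close>

context left_module
begin

lemma smult_zero_right [simp]:
  assumes "b \<in> carrier R" shows "b \<odot>\<^bsub>M\<^esub> \<zero>\<^bsub>M\<^esub> = \<zero>\<^bsub>M\<^esub>"
proof -
  have "b \<odot>\<^bsub>M\<^esub> \<zero>\<^bsub>M\<^esub> \<oplus>\<^bsub>M\<^esub> b \<odot>\<^bsub>M\<^esub> \<zero>\<^bsub>M\<^esub> = b \<odot>\<^bsub>M\<^esub> \<zero>\<^bsub>M\<^esub>"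
    using smult_r_distr[OF assms M.zero_closed M.zero_closed] by simp
  then show ?thesis
    using M.add.r_cancel_one[of "b \<odot>\<^bsub>M\<^esub> \<zero>\<^bsub>M\<^esub>" "b \<odot>\<^bsub>M\<^esub> \<zero>\<^bsub>M\<^esub>"] smult_closed[OF assms M.zero_closed] by simp
qed

lemma smult_zero_left [simp]:
  assumes "x \<in> carrier M" shows "\<zero>\<^bsub>R\<^esub> \<odot>\<^bsub>M\<^esub> x = \<zero>\<^bsub>M\<^esub>"
proof -
  have "\<zero>\<^bsub>R\<^esub> \<odot>\<^bsub>M\<^esub> x \<oplus>\<^bsub>M\<^esub> \<zero>\<^bsub>R\<^esub> \<odot>\<^bsub>M\<^esub> x = \<zero>\<^bsub>R\<^esub> \<odot>\<^bsub>M\<^esub> x"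
    using smult_l_distr[OF R.zero_closed R.zero_closed assms] by simp
  then show ?thesis
    using M.add.r_cancel_one[of "\<zero>\<^bsub>R\<^esub> \<odot>\<^bsub>M\<^esub> x" "\<zero>\<^bsub>R\<^esub> \<odot>\<^bsub>M\<^esub> x"] smult_closed[OF R.zero_closed assms] by simp
qed

lemma smult_minus_one:
  assumes "x \<in> carrier M" shows "(\<ominus>\<^bsub>R\<^esub> \<one>\<^bsub>R\<^esub>) \<odot>\<^bsub>M\<^esub> x = \<ominus>\<^bsub>M\<^esub> x"
proof -
  have "(\<ominus>\<^bsub>R\<^esub> \<one>\<^bsub>R\<^esub>) \<odot>\<^bsub>M\<^esub> x \<oplus>\<^bsub>M\<^esub> x = \<zero>\<^bsub>M\<^esub>"
    using smult_l_distr[of "\<ominus>\<^bsub>R\<^esub> \<one>\<^bsub>R\<^esub>" "\<one>\<^bsub>R\<^esub>" x] assms by (simp add: R.l_neg smult_one)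
  then show ?thesis
    using assms M.minus_equality smult_closed[of "\<ominus>\<^bsub>R\<^esub> \<one>\<^bsub>R\<^esub>" x] by simp
qed

lemma submoduleI:
  assumes "H \<subseteq> carrier M" and "\<zero>\<^bsub>M\<^esub> \<in> H"
    and "\<And>x y. x \<in> H \<Longrightarrow> y \<in> H \<Longrightarrow> x \<oplus>\<^bsub>M\<^esub> y \<in> H"
    and smult: "\<And>b x. b \<in> carrier R \<Longrightarrow> x \<in> H \<Longrightarrow> b \<odot>\<^bsub>M\<^esub> x \<in> H"
  shows "Module.submodule H R M"
proof (intro Module.submodule.intro submodule_axioms.intro smult)
  have "\<ominus>\<^bsub>M\<^esub> x \<in> H" if "x \<in> H" for x
    using smult[of "\<ominus>\<^bsub>R\<^esub> \<one>\<^bsub>R\<^esub>" x] that assms(1) smult_minus_one[of x] by auto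
  then show "subgroup H (add_monoid M)"
    using assms by (intro M.add.subgroupI) (auto simp: a_inv_def)
qed

end

lemma simple_moduleD:
  assumes "simple_module R M" and "Module.submodule H R M"
  shows "H = {\<zero>\<^bsub>M\<^esub>} \<or> H = carrier M"
  using assms by (simp add: simple_module_def)

lemma simple_module_left_module: "simple_module R M \<Longrightarrow> left_module R M"
  by (simp add: simple_module_def)

text \<open>Schur's lemma: the kernel and the image are submodules, and the hypothesis that \<open>f\<close> is nonzero
  leaves only the trivial kernel and the full image.\<close>

lemma nonzero_hom_between_simple_modules_bij:
  assumes M: "simple_module R M" and N: "simple_module R N"
    and f: "f \<in> LinearCombinations.module_hom R M N"
    and nonzero: "\<exists>x\<in>carrier M. f x \<noteq> \<zero>\<^bsub>N\<^esub>"
  shows "bij_betw f (carrier M) (carrier N)"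
proof -
  interpret M: left_module R M by (rule simple_module_left_module[OF M])
  interpret N: left_module R N by (rule simple_module_left_module[OF N])
  note f_simps = LinearCombinations.module_hom_add[OF f] LinearCombinations.module_hom_smult[OF f]
  have f_closed: "f x \<in> carrier N" if "x \<in> carrier M" for x
    using LinearCombinations.module_hom_closed[OF f] that by auto
  have f_zero: "f \<zero>\<^bsub>M\<^esub> = \<zero>\<^bsub>N\<^esub>"
    using f_simps(2)[of "\<zero>\<^bsub>R\<^esub>" "\<zero>\<^bsub>M\<^esub>"] f_closed by simp
  let ?K = "{x \<in> carrier M. f x = \<zero>\<^bsub>N\<^esub>}"
  have "Module.submodule ?K R M"
    by (rule M.submoduleI) (auto simp: f_zero f_simps M.smult_closed)
  then have K: "?K = {\<zero>\<^bsub>M\<^esub>}"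
    using simple_moduleD[OF M] nonzero by blast
  have "Module.submodule (f ` carrier M) R N"
  proof (rule N.submoduleI)
    show "\<zero>\<^bsub>N\<^esub> \<in> f ` carrier M" using f_zero by (metis M.M.zero_closed image_eqI)
  next
    fix x y assume "x \<in> f ` carrier M" "y \<in> f ` carrier M"
    then show "x \<oplus>\<^bsub>N\<^esub> y \<in> f ` carrier M"
      using f_simps(1) by (auto simp flip: f_simps(1))
  next
    fix b y assume "b \<in> carrier R" "y \<in> f ` carrier M"
    then show "b \<odot>\<^bsub>N\<^esub> y \<in> f ` carrier M"
      by (auto simp flip: f_simps(2) simp: M.smult_closed)
  qed (use f_closed in auto)
  then have surj: "f ` carrier M = carrier N"
    using simple_moduleD[OF N] nonzero by blast
  have "inj_on f (carrier M)"
  proof (rule inj_onI)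
    fix x y assume xy: "x \<in> carrier M" "y \<in> carrier M" "f x = f y"
    have m: "f (\<ominus>\<^bsub>M\<^esub> y) = \<ominus>\<^bsub>N\<^esub> f y"
      using f_simps(2)[of "\<ominus>\<^bsub>R\<^esub> \<one>\<^bsub>R\<^esub>" y] xy f_closed by (simp add: M.smult_minus_one N.smult_minus_one)
    have "f (x \<oplus>\<^bsub>M\<^esub> \<ominus>\<^bsub>M\<^esub> y) = \<zero>\<^bsub>N\<^esub>"
      using xy f_closed by (simp add: f_simps m N.M.r_neg)
    then have "x \<oplus>\<^bsub>M\<^esub> \<ominus>\<^bsub>M\<^esub> y = \<zero>\<^bsub>M\<^esub>" using K xy by auto
    then show "x = y" using xy by (metis M.M.minus_equality M.M.minus_minus M.M.a_inv_closed)
  qed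
  then show ?thesis using surj by (simp add: bij_betw_def)
qed

lemma module_isomorphic_sym:
  assumes "left_module R M" and "module_isomorphic R M N"
  shows "module_isomorphic R N M"
proof -
  interpret left_module R M by fact
  obtain f where f: "f \<in> LinearCombinations.module_hom R M N" "bij_betw f (carrier M) (carrier N)"
    using assms(2) by (auto simp: module_isomorphic_def)
  let ?g = "inv_into (carrier M) f"
  have g: "bij_betw ?g (carrier N) (carrier M)" by (rule bij_betw_inv_into[OF f(2)])
  have gc: "?g y \<in> carrier M" if "y \<in> carrier N" for y using g that by (auto simp: bij_betw_def)
  have fg: "f (?g y) = y" if "y \<in> carrier N" for y using f(2) that by (simp add: bij_betw_inv_into_right)
  have gf: "?g (f x) = x" if "x \<in> carrier M" for x using f(2) that by (simp add: bij_betw_inv_into_left)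
  have "?g (x \<oplus>\<^bsub>N\<^esub> y) = ?g x \<oplus>\<^bsub>M\<^esub> ?g y" if "x \<in> carrier N" "y \<in> carrier N" for x y
    using gf[of "?g x \<oplus>\<^bsub>M\<^esub> ?g y"] that gc fg by (simp add: LinearCombinations.module_hom_add[OF f(1)])
  moreover have "?g (b \<odot>\<^bsub>N\<^esub> y) = b \<odot>\<^bsub>M\<^esub> ?g y" if "b \<in> carrier R" "y \<in> carrier N" for b y
    using gf[of "b \<odot>\<^bsub>M\<^esub> ?g y"] that gc fg by (simp add: LinearCombinations.module_hom_smult[OF f(1)] smult_closed)
  ultimately have "?g \<in> LinearCombinations.module_hom R N M"
    using gc by (simp add: LinearCombinations.module_hom_def)
  then show ?thesis using g by (auto simp: module_isomorphic_def)
qed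

lemma vectorspace_restrict_scalars:
  fixes R :: "('r, 'k) ring_scheme" and M :: "('r, 'v) module"
  assumes M: "left_module R M" and K: "field K" and h: "h \<in> Ring.ring_hom K R"
  shows "vectorspace K (restrict_scalars h M)"
proof -
  interpret left_module R M by (rule M)
  interpret K: field K by (rule K)
  have hc: "h c \<in> carrier R" if "c \<in> carrier K" for c by (rule Ring.ring_hom_closed[OF h that])
  show ?thesis
    by (rule vs_criteria[OF K])
      (auto simp: restrict_scalars_def hc smult_closed Ring.ring_hom_add[OF h] Ring.ring_hom_mult[OF h]
        Ring.ring_hom_one[OF h] smult_l_distr smult_r_distr smult_assoc smult_one M.add.m_ac
        intro!: bexI[of _ "\<ominus>\<^bsub>M\<^esub> _"] simp: M.r_neg)
qed

lemma bij_linear_map_fin_dim_dim: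
  assumes V: "vectorspace K V" and W: "vectorspace K W"
    and f: "f \<in> LinearCombinations.module_hom K V W" "bij_betw f (carrier V) (carrier W)"
    and fin: "vectorspace.fin_dim K V"
  shows "vectorspace.fin_dim K W" and "vectorspace.dim K W = vectorspace.dim K V"
proof -
  interpret V: vectorspace K V by (rule V)
  interpret W: vectorspace K W by (rule W)
  interpret linear_map K V W f by unfold_locales (rule f(1))
  show "W.fin_dim" using f(2) fin by (intro surj_fin_dim) (auto simp: bij_betw_def)
  show "W.dim = V.dim" using f(2) fin by (intro dim_eq[symmetric]) (auto simp: bij_betw_def)
qed


section \<open>Elements of the algebra\<close>

lemma B_ring_simps [simp]:
  "mult (B_ring a lam) = mult (A_ring a)" "add (B_ring a lam) = add (A_ring a)"
  "one (B_ring a lam) = one (A_ring a)" "zero (B_ring a lam) = zero (A_ring a)"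
  by (simp_all add: B_ring_def)

lemma B_carrier_subset_A: "b \<in> carrier (B_ring a lam) \<Longrightarrow> b \<in> carrier (A_ring a)"
  using ring.generate_ring_in_carrier[OF ring_A_ring generators_in_A_ring[of a lam]]
  by (auto simp: B_ring_def)

lemma A_component:
  assumes "n \<in> supp a" "i \<in> {1..a n}"
  shows "(x \<otimes>\<^bsub>A_ring a\<^esub> y) n i = x n i * y n i" "(x \<oplus>\<^bsub>A_ring a\<^esub> y) n i = x n i + y n i"
    "\<one>\<^bsub>A_ring a\<^esub> n i = 1\<^sub>m n" "\<zero>\<^bsub>A_ring a\<^esub> n i = 0\<^sub>m n n"
  using assms by (auto simp: A_ring_def product_ring_simps ring_mat_simps)

lemma A_component_carrier:
  assumes "x \<in> carrier (A_ring a)" "n \<in> supp a" "i \<in> {1..a n}"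
  shows "x n i \<in> carrier_mat n n"
  using assms by (auto simp: A_ring_def product_ring_simps ring_mat_simps PiE_iff)

lemma A_eqI:
  assumes x: "x \<in> carrier (A_ring a)" and y: "y \<in> carrier (A_ring a)"
    and eq: "\<And>n i. n \<in> supp a \<Longrightarrow> i \<in> {1..a n} \<Longrightarrow> x n i = y n i"
  shows "x = y"
proof (rule extensionalityI)
  show "x \<in> extensional (supp a)" "y \<in> extensional (supp a)"
    using x y by (auto simp: A_ring_def product_ring_simps PiE_iff)
  fix n assume n: "n \<in> supp a"
  show "x n = y n"
  proof (rule extensionalityI)
    show "x n \<in> extensional {1..a n}" "y n \<in> extensional {1..a n}"
      using x y n by (auto simp: A_ring_def product_ring_simps PiE_iff)
  qed (use eq n in auto)
qed

lemma A_memI: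
  assumes "\<And>n i. n \<in> supp a \<Longrightarrow> i \<in> {1..a n} \<Longrightarrow> f n i \<in> carrier_mat n n"
  shows "(\<lambda>n\<in>supp a. \<lambda>i\<in>{1..a n}. f n i) \<in> carrier (A_ring a)"
  using assms by (auto simp: A_ring_def product_ring_simps ring_mat_simps)

text \<open>The \<open>k\<close>-th power of \<open>\<sigma>\<close>, written out as the matrix of the cyclic shift by \<open>k\<close>.\<close>

definition sigma_pow :: "(nat \<Rightarrow> nat) \<Rightarrow> nat \<Rightarrow> nat \<Rightarrow> nat \<Rightarrow> 'a::field mat" where
  "sigma_pow a k = (\<lambda>n\<in>supp a. \<lambda>i\<in>{1..a n}.
     mat n n (\<lambda>(r, s). if s = (r + k) mod n then 1 else 0))"

lemma e_elem_A: "e_elem a g \<in> carrier (A_ring a)"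
  unfolding e_elem_def by (rule A_memI) auto

lemma diag_elem_A: "diag_elem a c \<in> carrier (A_ring a)"
  unfolding diag_elem_def by (rule A_memI) auto

lemma sigma_pow_A: "sigma_pow a k \<in> carrier (A_ring a)"
  unfolding sigma_pow_def by (rule A_memI) auto

lemma A_mult_closed:
  "x \<in> carrier (A_ring a) \<Longrightarrow> y \<in> carrier (A_ring a) \<Longrightarrow> x \<otimes>\<^bsub>A_ring a\<^esub> y \<in> carrier (A_ring a)"
  by (rule ring.ring_simprules(5)[OF ring_A_ring])

lemma A_add_closed:
  "x \<in> carrier (A_ring a) \<Longrightarrow> y \<in> carrier (A_ring a) \<Longrightarrow> x \<oplus>\<^bsub>A_ring a\<^esub> y \<in> carrier (A_ring a)"
  by (rule ring.ring_simprules(1)[OF ring_A_ring])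

lemma A_one_closed: "\<one>\<^bsub>A_ring a\<^esub> \<in> carrier (A_ring a)"
  by (rule ring.ring_simprules(6)[OF ring_A_ring])

lemma A_zero_closed: "\<zero>\<^bsub>A_ring a\<^esub> \<in> carrier (A_ring a)"
  by (rule ring.ring_simprules(2)[OF ring_A_ring])

lemmas A_closed = e_elem_A diag_elem_A sigma_pow_A A_mult_closed A_add_closed
  A_one_closed A_zero_closed

lemma sigma_pow_1: "sigma_pow a 1 = sigma_elem a"
proof -
  have "mat n n (\<lambda>(r, s). if s = (r + 1) mod n then 1 else 0) =
    four_block_mat (0\<^sub>m (n - 1) 1) (1\<^sub>m (n - 1)) (1\<^sub>m 1) (0\<^sub>m 1 (n - 1))" (is "?L = ?R")
    if n: "n \<in> supp a" for n
  proof (rule eq_matI)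
    have n2: "n \<ge> 2" using n by (simp add: supp_def)
    show "dim_row ?L = dim_row ?R" "dim_col ?L = dim_col ?R" using n2 by auto
    fix r s assume "r < dim_row ?R" "s < dim_col ?R"
    then have rs: "r < n" "s < n" using n2 by auto
    have m: "(r + 1) mod n = (if r = n - 1 then 0 else r + 1)" using rs n2 by auto
    show "?L $$ (r, s) = ?R $$ (r, s)"
      using rs n2 by (cases "r = n - 1") (auto simp: m simp del: One_nat_def)
  qed
  then show ?thesis by (auto simp: sigma_pow_def sigma_elem_def intro!: restrict_ext)
qed

lemma sigma_pow_0: "sigma_pow a 0 = \<one>\<^bsub>A_ring a\<^esub>"
proof (rule A_eqI)
  fix n i assume "n \<in> supp a" "i \<in> {1..a n}"
  then show "sigma_pow a 0 n i = \<one>\<^bsub>A_ring a\<^esub> n i"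
    by (auto simp: A_component sigma_pow_def intro!: eq_matI)
qed (rule A_closed)+

lemma index_mult_mat_sum:
  assumes "A \<in> carrier_mat n n" "B \<in> carrier_mat n n" "r < n" "s < n"
  shows "(A * B) $$ (r, s) = (\<Sum>k<n. A $$ (r, k) * B $$ (k, s))"
  using assms by (auto simp: scalar_prod_def atLeast0LessThan intro!: sum.cong)

lemma sigma_pow_add:
  "sigma_pow a k \<otimes>\<^bsub>A_ring a\<^esub> sigma_pow a l = (sigma_pow a (k + l) :: nat \<Rightarrow> nat \<Rightarrow> 'a::field mat)"
proof (rule A_eqI)
  fix n i assume ni: "n \<in> supp a" "i \<in> {1..a n}"
  then have n: "n > 0" by (simp add: supp_def)
  let ?C = "\<lambda>k. mat n n (\<lambda>(r, s). if s = (r + k) mod n then 1 else 0) :: 'a mat"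
  have "?C k * ?C l = ?C (k + l)"
  proof (rule eq_matI)
    fix r s assume "r < dim_row (?C (k + l))" "s < dim_col (?C (k + l))"
    then have rs: "r < n" "s < n" by auto
    have "(?C k * ?C l) $$ (r, s) = (\<Sum>j<n. ?C k $$ (r, j) * ?C l $$ (j, s))"
      using rs by (intro index_mult_mat_sum) auto
    also have "\<dots> = (\<Sum>j<n. if j = (r + k) mod n then ?C l $$ (j, s) else 0)"
      using rs by (intro sum.cong) auto
    also have "\<dots> = ?C l $$ ((r + k) mod n, s)" using n by simp
    also have "\<dots> = ?C (k + l) $$ (r, s)"
      using rs n by (simp add: mod_add_left_eq add.assoc)
    finally show "(?C k * ?C l) $$ (r, s) = ?C (k + l) $$ (r, s)" .
  qed auto
  moreover have "sigma_pow a k n i = (?C k :: 'a mat)" for k using ni by (simp add: sigma_pow_def)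
  ultimately show "(sigma_pow a k \<otimes>\<^bsub>A_ring a\<^esub> sigma_pow a l) n i = (sigma_pow a (k + l) n i :: 'a mat)"
    by (simp only: A_component(1)[OF ni])
qed (auto simp: A_closed)

lemma e_elem_add: "e_elem a g \<oplus>\<^bsub>A_ring a\<^esub> e_elem a h = e_elem a (\<lambda>n i. g n i + h n i)"
proof (rule A_eqI)
  fix n i assume "n \<in> supp a" "i \<in> {1..a n}"
  then show "(e_elem a g \<oplus>\<^bsub>A_ring a\<^esub> e_elem a h) n i = e_elem a (\<lambda>n i. g n i + h n i) n i"
    by (auto simp: A_component e_elem_def intro!: eq_matI)
qed (simp_all add: A_closed)

lemma diag_mult_e_elem: "diag_elem a c \<otimes>\<^bsub>A_ring a\<^esub> e_elem a g = e_elem a (\<lambda>n i. c * g n i)"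
proof (rule A_eqI)
  fix n i assume ni: "n \<in> supp a" "i \<in> {1..a n}"
  let ?E = "e_elem a g n i"
  have E: "?E \<in> carrier_mat n n" by (rule A_component_carrier[OF e_elem_A ni])
  have "(c \<cdot>\<^sub>m 1\<^sub>m n) * ?E = c \<cdot>\<^sub>m ?E"
    using mult_smult_assoc_mat[OF one_carrier_mat E, of c] left_mult_one_mat[OF E] by simp
  also have "\<dots> = e_elem a (\<lambda>n i. c * g n i) n i"
    using ni by (auto simp: e_elem_def intro!: eq_matI)
  finally show "(diag_elem a c \<otimes>\<^bsub>A_ring a\<^esub> e_elem a g) n i = e_elem a (\<lambda>n i. c * g n i) n i"
    using ni by (simp add: A_component diag_elem_def)
qed (auto simp: A_closed)

text \<open>The upper left entry of the shift by \<open>k\<close> in size \<open>n\<close> is \<open>1\<close> if \<open>n\<close> divides \<open>k\<close> and \<open>0\<close> otherwise. Hence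
  \<open>e \<sigma>\<^sup>k e\<close> detects divisibility, and for \<open>k > 0\<close> it lives in finitely many factors. Here and
  below \<open>e_elem a g\<close> is used for arbitrary corner entries \<open>g\<close>, not only for the weights.\<close>

lemma e_sigma_pow_e:
  fixes g h :: "nat \<Rightarrow> nat \<Rightarrow> 'a::field"
  shows "e_elem a g \<otimes>\<^bsub>A_ring a\<^esub> sigma_pow a k \<otimes>\<^bsub>A_ring a\<^esub> e_elem a h =
   e_elem a (\<lambda>n i. if n dvd k then g n i * h n i else 0)"
proof (rule A_eqI)
  fix n i assume ni: "n \<in> supp a" "i \<in> {1..a n}"
  then have n: "n > 0" by (simp add: supp_def)
  let ?C = "mat n n (\<lambda>(r, s). if s = (r + k) mod n then 1 else 0) :: 'a mat"
  let ?E = "\<lambda>x. mat n n (\<lambda>(r, s). if r = 0 \<and> s = 0 then x else 0) :: 'a mat"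
  have dvd0: "0 = k mod n \<longleftrightarrow> n dvd k" by (metis dvd_eq_mod_eq_0)
  have EC: "(?E x * ?C) $$ (r, j) = (if r = 0 \<and> j = k mod n then x else 0)" if "r < n" "j < n" for r j x
  proof -
    have "(?E x * ?C) $$ (r, j) = (\<Sum>l<n. ?E x $$ (r, l) * ?C $$ (l, j))"
      using that by (intro index_mult_mat_sum) auto
    also have "\<dots> = (\<Sum>l<n. if l = 0 then (if r = 0 then x * ?C $$ (l, j) else 0) else 0)"
      using that by (intro sum.cong) auto
    finally show ?thesis using that n by simp
  qed
  have "(?E x * ?C) * ?E y = ?E (if n dvd k then x * y else 0)" for x y
  proof (rule eq_matI)
    fix r s assume "r < dim_row (?E (if n dvd k then x * y else 0))" "s < dim_col (?E (if n dvd k then x * y else 0))"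
    then have rs: "r < n" "s < n" by auto
    have "((?E x * ?C) * ?E y) $$ (r, s) = (\<Sum>j<n. (?E x * ?C) $$ (r, j) * ?E y $$ (j, s))"
      using rs by (intro index_mult_mat_sum) auto
    also have "\<dots> = (\<Sum>j<n. if j = 0 then (if s = 0 then (?E x * ?C) $$ (r, j) * y else 0) else 0)"
      using rs by (intro sum.cong) auto
    also have "\<dots> = (if s = 0 then (?E x * ?C) $$ (r, 0) * y else 0)" using n by simp
    also have "\<dots> = ?E (if n dvd k then x * y else 0) $$ (r, s)"
      using rs n by (simp add: EC dvd0 del: index_mult_mat)
    finally show "((?E x * ?C) * ?E y) $$ (r, s) = ?E (if n dvd k then x * y else 0) $$ (r, s)" .
  qed auto
  then show "(e_elem a g \<otimes>\<^bsub>A_ring a\<^esub> sigma_pow a k \<otimes>\<^bsub>A_ring a\<^esub> e_elem a h) n i =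
      e_elem a (\<lambda>n i. if n dvd k then g n i * h n i else 0) n i"
    using ni by (simp add: A_component e_elem_def sigma_pow_def)
qed (auto simp: A_closed)

lemma e_elem_mult: "e_elem a g \<otimes>\<^bsub>A_ring a\<^esub> e_elem a h = e_elem a (\<lambda>n i. g n i * h n i)"
  using e_sigma_pow_e[of a g 0 h] ring.ring_simprules(13)[OF ring_A_ring]
  by (simp add: sigma_pow_0 monoid.r_one[OF ring.is_monoid[OF ring_A_ring]] e_elem_A)

lemma e_elem_cong:
  "(\<And>n i. n \<in> supp a \<Longrightarrow> i \<in> {1..a n} \<Longrightarrow> g n i = h n i) \<Longrightarrow> e_elem a g = e_elem a h"
  unfolding e_elem_def by (intro restrict_ext) (simp only:)

lemma e_elem_zero: "e_elem a (\<lambda>_ _. 0) = (\<zero>\<^bsub>A_ring a\<^esub> :: nat \<Rightarrow> nat \<Rightarrow> 'a::field mat)"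
proof (rule A_eqI)
  fix n i assume "n \<in> supp a" "i \<in> {1..a n}"
  then show "e_elem a (\<lambda>_ _. 0) n i = (\<zero>\<^bsub>A_ring a\<^esub> n i :: 'a mat)"
    by (auto simp: e_elem_def A_component intro!: eq_matI)
qed (simp_all add: A_closed)

lemma diag_elem_central:
  assumes "x \<in> carrier (A_ring a)"
  shows "x \<otimes>\<^bsub>A_ring a\<^esub> diag_elem a c = diag_elem a c \<otimes>\<^bsub>A_ring a\<^esub> x"
proof (rule A_eqI)
  fix n i assume ni: "n \<in> supp a" "i \<in> {1..a n}"
  note X = A_component_carrier[OF assms ni]
  have "x n i * (c \<cdot>\<^sub>m 1\<^sub>m n) = (c \<cdot>\<^sub>m 1\<^sub>m n) * x n i"
    using mult_smult_distrib[OF X one_carrier_mat, of c] mult_smult_assoc_mat[OF one_carrier_mat X, of c]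
      left_mult_one_mat[OF X] right_mult_one_mat[OF X] by simp
  then show "(x \<otimes>\<^bsub>A_ring a\<^esub> diag_elem a c) n i = (diag_elem a c \<otimes>\<^bsub>A_ring a\<^esub> x) n i"
    using ni by (simp add: A_component diag_elem_def)
qed (use assms in \<open>simp_all add: A_closed\<close>)

lemma B_mult_closed:
  "x \<in> carrier (B_ring a lam) \<Longrightarrow> y \<in> carrier (B_ring a lam) \<Longrightarrow>
    x \<otimes>\<^bsub>A_ring a\<^esub> y \<in> carrier (B_ring a lam)"
  by (simp add: B_ring_def generate_ring.eng_mult)

lemma B_add_closed:
  "x \<in> carrier (B_ring a lam) \<Longrightarrow> y \<in> carrier (B_ring a lam) \<Longrightarrow>
    x \<oplus>\<^bsub>A_ring a\<^esub> y \<in> carrier (B_ring a lam)"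
  by (simp add: B_ring_def generate_ring.eng_add)

lemma B_one_closed: "\<one>\<^bsub>A_ring a\<^esub> \<in> carrier (B_ring a lam)"
  by (simp add: B_ring_def generate_ring.one)

lemma diag_elem_B: "diag_elem a c \<in> carrier (B_ring a lam)"
  by (simp add: B_ring_def generate_ring.incl)

lemma e_elem_B: "e_elem a lam \<in> carrier (B_ring a lam)"
  by (simp add: B_ring_def generate_ring.incl)

lemma sigma_elem_B: "sigma_elem a \<in> carrier (B_ring a lam)"
  by (simp add: B_ring_def generate_ring.incl)

lemma sigma_pow_B: "sigma_pow a k \<in> carrier (B_ring a lam)"
proof (induct k)
  case 0
  show ?case by (simp add: sigma_pow_0 B_one_closed)
next
  case (Suc k)
  have "sigma_elem a \<otimes>\<^bsub>A_ring a\<^esub> sigma_pow a k = (sigma_pow a (Suc k) :: nat \<Rightarrow> nat \<Rightarrow> 'a mat)"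
    unfolding sigma_pow_1[symmetric] sigma_pow_add by simp
  then show ?case using B_mult_closed[OF sigma_elem_B Suc] by simp
qed

lemmas B_closed = B_mult_closed B_add_closed B_one_closed diag_elem_B e_elem_B sigma_elem_B sigma_pow_B

text \<open>Multiplying \<open>e \<sigma>\<^sup>k e\<close> by \<open>e - c\<close> multiplies each corner entry by \<open>\<lambda> - c\<close>, so factors whose weight
  occurs in \<open>C\<close> are erased.\<close>

lemma e_elem_poly_B:
  assumes "finite C"
  shows "e_elem a (\<lambda>m j. if m dvd k then (\<Prod>c\<in>C. lam m j - c) * (lam m j * lam m j) else 0)
    \<in> carrier (B_ring a lam)" (is "?P C \<in> _")
  using assms
proof (induct C)
  case empty
  have "?P {} = e_elem a lam \<otimes>\<^bsub>A_ring a\<^esub> sigma_pow a k \<otimes>\<^bsub>A_ring a\<^esub> e_elem a lam"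
    unfolding e_sigma_pow_e by (simp cong: if_cong)
  then show ?case by (simp add: B_closed)
next
  case (insert c C)
  have "?P (insert c C) = e_elem a lam \<otimes>\<^bsub>A_ring a\<^esub> ?P C \<oplus>\<^bsub>A_ring a\<^esub> (diag_elem a (- c) \<otimes>\<^bsub>A_ring a\<^esub> ?P C)"
    unfolding e_elem_mult diag_mult_e_elem e_elem_add
    by (rule arg_cong[where f = "e_elem a"], intro ext) (use insert in \<open>simp add: algebra_simps\<close>)
  then show ?case using insert by (simp add: B_closed)
qed


section \<open>Elements supported in one factor\<close>

text \<open>The matrix \<open>X\<close> in the \<open>i\<close>-th factor of size \<open>n\<close>, and zero in all other factors.\<close>

definition single :: "(nat \<Rightarrow> nat) \<Rightarrow> nat \<Rightarrow> nat \<Rightarrow> 'a mat \<Rightarrow> nat \<Rightarrow> nat \<Rightarrow> 'a::field mat" where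
  "single a n i X = (\<lambda>m\<in>supp a. \<lambda>j\<in>{1..a m}. if m = n \<and> j = i then X else 0\<^sub>m m m)"

lemma single_A: "X \<in> carrier_mat n n \<Longrightarrow> single a n i X \<in> carrier (A_ring a)"
  unfolding single_def by (rule A_memI) auto

lemma single_component:
  assumes "m \<in> supp a" "j \<in> {1..a m}"
  shows "single a n i X m j = (if m = n \<and> j = i then X else 0\<^sub>m m m)"
  using assms by (simp add: single_def)

lemma single_add:
  assumes "X \<in> carrier_mat n n" "Y \<in> carrier_mat n n"
  shows "single a n i X \<oplus>\<^bsub>A_ring a\<^esub> single a n i Y = single a n i (X + Y)"
proof (rule A_eqI)
  fix m j assume "m \<in> supp a" "j \<in> {1..a m}"
  then show "(single a n i X \<oplus>\<^bsub>A_ring a\<^esub> single a n i Y) m j = single a n i (X + Y) m j"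
    by (simp only: A_component single_component) auto
qed (use assms in \<open>simp_all add: A_closed single_A\<close>)

lemma A_mult_single:
  assumes "X \<in> carrier_mat n n" "n \<in> supp a" "i \<in> {1..a n}" "b \<in> carrier (A_ring a)"
  shows "b \<otimes>\<^bsub>A_ring a\<^esub> single a n i X = single a n i (b n i * X)"
proof (rule A_eqI)
  fix m j assume mj: "m \<in> supp a" "j \<in> {1..a m}"
  have "b m j * 0\<^sub>m m m = 0\<^sub>m m m" using A_component_carrier[OF assms(4) mj] by (rule right_mult_zero_mat)
  then show "(b \<otimes>\<^bsub>A_ring a\<^esub> single a n i X) m j = single a n i (b n i * X) m j"
    using mj by (simp only: A_component single_component) auto
qed (use assms A_component_carrier[OF assms(4,2,3)] in \<open>auto intro!: A_closed single_A mult_carrier_mat\<close>)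

lemma single_mult_A:
  assumes "X \<in> carrier_mat n n" "n \<in> supp a" "i \<in> {1..a n}" "b \<in> carrier (A_ring a)"
  shows "single a n i X \<otimes>\<^bsub>A_ring a\<^esub> b = single a n i (X * b n i)"
proof (rule A_eqI)
  fix m j assume mj: "m \<in> supp a" "j \<in> {1..a m}"
  have "0\<^sub>m m m * b m j = 0\<^sub>m m m" using A_component_carrier[OF assms(4) mj] by (rule left_mult_zero_mat)
  then show "(single a n i X \<otimes>\<^bsub>A_ring a\<^esub> b) m j = single a n i (X * b n i) m j"
    using mj by (simp only: A_component single_component) auto
qed (use assms A_component_carrier[OF assms(4,2,3)] in \<open>auto intro!: A_closed single_A mult_carrier_mat\<close>)

abbreviation mat_unit :: "nat \<Rightarrow> nat \<Rightarrow> nat \<Rightarrow> 'a \<Rightarrow> 'a::field mat" where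
  "mat_unit n p q x \<equiv> mat n n (\<lambda>(r, s). if r = p \<and> s = q then x else 0)"

lemma single_mat_unit_eq_e_elem:
  "single a n i (mat_unit n 0 0 x) = e_elem a (\<lambda>m j. if m = n \<and> j = i then x else 0)"
  by (auto simp: single_def e_elem_def intro!: restrict_ext eq_matI)

text \<open>Shifting rows and columns moves the upper left corner to any position. The exponent \<open>n - p\<close> stands
  for \<open>- p\<close>, as \<open>\<sigma>\<close> has order \<open>n\<close> in a factor of size \<open>n\<close>.\<close>

lemma sigma_pow_single_sigma_pow:
  assumes n: "n \<in> supp a" and i: "i \<in> {1..a n}" and pq: "p < n" "q < n"
  shows "sigma_pow a (n - p) \<otimes>\<^bsub>A_ring a\<^esub> single a n i (mat_unit n 0 0 x) \<otimes>\<^bsub>A_ring a\<^esub> sigma_pow a q =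
    single a n i (mat_unit n p q x)"
proof -
  let ?C = "\<lambda>k. mat n n (\<lambda>(r, s). if s = (r + k) mod n then 1 else 0) :: 'a mat"
  let ?E = "mat_unit n 0 0 x"
  have npos: "n > 0" using n by (simp add: supp_def)
  have C: "sigma_pow a k n i = (?C k :: 'a mat)" for k using n i by (simp add: sigma_pow_def)
  have shift: "0 = (r + (n - p)) mod n \<longleftrightarrow> r = p" if "r < n" for r
  proof (cases "r < p")
    case True
    then have "r + (n - p) < n" "r + (n - p) \<noteq> 0" using pq by linarith+
    then show ?thesis using True by (simp only: mod_less) simp
  next
    case False
    then have "r + (n - p) = (r - p) + n" using pq by linarith
    then have "(r + (n - p)) mod n = (r - p) mod n" by (simp only: mod_add_self2)
    then have "(r + (n - p)) mod n = r - p" using that by simp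
    then show ?thesis using False by linarith
  qed
  have left: "?C (n - p) * ?E = mat_unit n p 0 x"
  proof (rule eq_matI)
    fix r s assume "r < dim_row (mat_unit n p 0 x)" "s < dim_col (mat_unit n p 0 x)"
    then have rs: "r < n" "s < n" by auto
    have "(?C (n - p) * ?E) $$ (r, s) = (\<Sum>k<n. ?C (n - p) $$ (r, k) * ?E $$ (k, s))"
      using rs by (intro index_mult_mat_sum) auto
    also have "\<dots> = (\<Sum>k<n. if k = 0 then (if r = p \<and> s = 0 then x else 0) else 0)"
      using rs shift[of r] by (intro sum.cong) auto
    finally show "(?C (n - p) * ?E) $$ (r, s) = mat_unit n p 0 x $$ (r, s)"
      using rs npos by (simp del: index_mult_mat)
  qed auto
  have right: "mat_unit n p 0 x * ?C q = mat_unit n p q x"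
  proof (rule eq_matI)
    fix r s assume "r < dim_row (mat_unit n p q x)" "s < dim_col (mat_unit n p q x)"
    then have rs: "r < n" "s < n" by auto
    have "(mat_unit n p 0 x * ?C q) $$ (r, s) = (\<Sum>k<n. mat_unit n p 0 x $$ (r, k) * ?C q $$ (k, s))"
      using rs by (intro index_mult_mat_sum) auto
    also have "\<dots> = (\<Sum>k<n. if k = 0 then (if r = p \<and> s = q then x else 0) else 0)"
      using rs pq by (intro sum.cong) auto
    finally show "(mat_unit n p 0 x * ?C q) $$ (r, s) = mat_unit n p q x $$ (r, s)"
      using rs npos by (simp del: index_mult_mat)
  qed auto
  have E: "?E \<in> carrier_mat n n" by simp
  have pE: "mat_unit n p 0 x \<in> carrier_mat n n" by simp
  show ?thesis
    unfolding A_mult_single[OF E n i sigma_pow_A] C left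
      single_mult_A[OF pE n i sigma_pow_A] right ..
qed

locale separated_weights =
  fixes a :: "nat \<Rightarrow> nat" and lam :: "nat \<Rightarrow> nat \<Rightarrow> 'a::field"
  assumes lam_nonzero: "\<And>n i. n \<in> supp a \<Longrightarrow> i \<in> {1..a n} \<Longrightarrow> lam n i \<noteq> 0"
    and lam_distinct: "inj_on (\<lambda>(n, i). lam n i) (SIGMA n : supp a. {1..a n})"
begin

abbreviation B where "B \<equiv> B_ring a lam"

text \<open>The element \<open>e \<sigma>\<^sup>n e\<close> is supported in the finitely many factors whose size divides \<open>n\<close>. As their
  weights are distinct, multiplying it by \<open>e - \<mu>\<close> for all of these weights \<open>\<mu>\<close> except \<open>\<lambda>\<^sub>n\<^sub>i\<close> leaves a
  nonzero corner in the factor \<open>(n, i)\<close> alone.\<close>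

lemma single_corner_B:
  assumes n: "n \<in> supp a" and i: "i \<in> {1..a n}"
  shows "single a n i (mat_unit n 0 0 x) \<in> carrier B"
proof -
  have npos: "n > 0" using n by (simp add: supp_def)
  let ?D = "(SIGMA m : {m \<in> supp a. m dvd n}. {1..a m}) - {(n, i)}"
  have "finite {m \<in> supp a. m dvd n}" using npos by (simp add: finite_divisors_nat)
  then have fin: "finite ((\<lambda>(m, j). lam m j) ` ?D)" by auto
  define g where "g m j = (if m dvd n then (\<Prod>c\<in>(\<lambda>(m, j). lam m j) ` ?D. lam m j - c) *
    (lam m j * lam m j) else 0)" for m j
  have gB: "e_elem a g \<in> carrier B"
    unfolding g_def by (rule e_elem_poly_B[OF fin])
  have g0: "g m j = 0" if "m \<in> supp a" "j \<in> {1..a m}" "(m, j) \<noteq> (n, i)" for m j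
  proof (cases "m dvd n")
    case True
    then have "lam m j \<in> (\<lambda>(m, j). lam m j) ` ?D"
      using that by (intro image_eqI[of _ _ "(m, j)"]) auto
    then have "(\<Prod>c\<in>(\<lambda>(m, j). lam m j) ` ?D. lam m j - c) = 0"
      using fin by (intro prod_zero) auto
    then show ?thesis by (simp add: g_def)
  qed (simp add: g_def)
  have "lam n i \<noteq> c" if c: "c \<in> (\<lambda>(m, j). lam m j) ` ?D" for c
  proof
    assume eq: "lam n i = c"
    obtain m j where mj: "(m, j) \<in> ?D" "c = lam m j"
      using c by (metis (no_types, lifting) imageE case_prod_conv surj_pair)
    then have "(n, i) = (m, j)"
      using eq n i by (intro inj_onD[OF lam_distinct]) auto
    then show False using mj by simp
  qed
  then have "(\<Prod>c\<in>(\<lambda>(m, j). lam m j) ` ?D. lam n i - c) \<noteq> 0"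
    using fin by (simp add: prod_zero_iff)
  then have g1: "g n i \<noteq> 0" using lam_nonzero[OF n i] by (simp add: g_def)
  have "diag_elem a (x / g n i) \<otimes>\<^bsub>A_ring a\<^esub> e_elem a g = single a n i (mat_unit n 0 0 x)"
    unfolding diag_mult_e_elem
  proof (rule A_eqI)
    fix m j assume mj: "m \<in> supp a" "j \<in> {1..a m}"
    show "e_elem a (\<lambda>m j. x / g n i * g m j) m j = single a n i (mat_unit n 0 0 x) m j"
      using mj g0[OF mj] g1 by (auto simp: e_elem_def single_component intro!: eq_matI)
  qed (simp_all add: A_closed single_A)
  then show ?thesis using B_mult_closed[OF diag_elem_B gB] by metis
qed

text \<open>Sums of shifted corners: the algebra contains each full matrix factor as an ideal.\<close>

lemma single_B:
  assumes n: "n \<in> supp a" and i: "i \<in> {1..a n}" and X: "X \<in> carrier_mat n n"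
  shows "single a n i X \<in> carrier B"
proof -
  have part: "single a n i (mat n n (\<lambda>rs. if rs \<in> C then X $$ rs else 0)) \<in> carrier B"
    if "finite C" "C \<subseteq> {..<n} \<times> {..<n}" for C
    using that
  proof (induct C)
    case empty
    have "mat n n (\<lambda>rs. if rs \<in> {} then X $$ rs else 0) = mat_unit n 0 0 0" by auto
    then show ?case using single_corner_B[OF n i, of 0] by simp
  next
    case (insert pq C)
    obtain p q where pq: "pq = (p, q)" "p < n" "q < n" using insert by auto
    let ?Y = "mat n n (\<lambda>rs. if rs \<in> C then X $$ rs else 0)"
    have "mat n n (\<lambda>rs. if rs \<in> insert pq C then X $$ rs else 0) = mat_unit n p q (X $$ pq) + ?Y"
      using insert(2) pq by (auto intro!: eq_matI)
    then have "single a n i (mat n n (\<lambda>rs. if rs \<in> insert pq C then X $$ rs else 0)) =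
        single a n i (mat_unit n p q (X $$ pq)) \<oplus>\<^bsub>A_ring a\<^esub> single a n i ?Y"
      by (simp add: single_add)
    moreover have "single a n i (mat_unit n p q (X $$ pq)) \<in> carrier B"
      unfolding sigma_pow_single_sigma_pow[OF n i pq(2,3), symmetric]
      by (intro B_mult_closed sigma_pow_B single_corner_B n i)
    ultimately show ?case using insert by (simp add: B_add_closed)
  qed
  moreover have "mat n n (\<lambda>rs. if rs \<in> {..<n} \<times> {..<n} then X $$ rs else 0) = X"
    using X by (auto intro!: eq_matI)
  ultimately show ?thesis using part[of "{..<n} \<times> {..<n}"] by simp
qed

end


section \<open>Restriction of scalars to the ground field\<close>

lemma diag_elem_ring_hom: "diag_elem a \<in> Ring.ring_hom class_ring (B_ring a lam)"
proof (rule Ring.ring_hom_memI)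
  fix c d :: 'a
  show "diag_elem a (c \<otimes>\<^bsub>class_ring\<^esub> d) = diag_elem a c \<otimes>\<^bsub>B_ring a lam\<^esub> diag_elem a d"
  proof (rule A_eqI)
    fix n i assume ni: "n \<in> supp a" "i \<in> {1..a n}"
    have "(c * d) \<cdot>\<^sub>m 1\<^sub>m n = (c \<cdot>\<^sub>m 1\<^sub>m n) * (d \<cdot>\<^sub>m 1\<^sub>m n)"
      using mult_smult_assoc_mat[OF one_carrier_mat, of "d \<cdot>\<^sub>m 1\<^sub>m n" n n c] by auto
    then show "diag_elem a (c \<otimes>\<^bsub>class_ring\<^esub> d) n i = (diag_elem a c \<otimes>\<^bsub>B_ring a lam\<^esub> diag_elem a d) n i"
      using ni by (simp add: A_component diag_elem_def)
  qed (simp_all add: A_closed)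
  show "diag_elem a (c \<oplus>\<^bsub>class_ring\<^esub> d) = diag_elem a c \<oplus>\<^bsub>B_ring a lam\<^esub> diag_elem a d"
  proof (rule A_eqI)
    fix n i assume ni: "n \<in> supp a" "i \<in> {1..a n}"
    then show "diag_elem a (c \<oplus>\<^bsub>class_ring\<^esub> d) n i = (diag_elem a c \<oplus>\<^bsub>B_ring a lam\<^esub> diag_elem a d) n i"
      by (simp add: A_component diag_elem_def add_smult_distrib_right_mat[OF one_carrier_mat])
  qed (simp_all add: A_closed)
next
  show "diag_elem a \<one>\<^bsub>class_ring\<^esub> = \<one>\<^bsub>B_ring a lam\<^esub>"
  proof (rule A_eqI)
    fix n i assume ni: "n \<in> supp a" "i \<in> {1..a n}"
    have "1 \<cdot>\<^sub>m 1\<^sub>m n = (1\<^sub>m n :: 'a mat)" by auto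
    then show "diag_elem a \<one>\<^bsub>class_ring\<^esub> n i = (\<one>\<^bsub>B_ring a lam\<^esub> n i :: 'a mat)"
      using ni by (simp add: A_component diag_elem_def)
  qed (simp_all add: A_closed)
qed (simp add: diag_elem_B)

lemma diag_elem_one: "diag_elem a 1 = \<one>\<^bsub>A_ring a\<^esub>"
  using Ring.ring_hom_one[OF diag_elem_ring_hom[of a]] by simp

lemma vectorspace_restrict_diag:
  fixes N :: "(nat \<Rightarrow> nat \<Rightarrow> 'a::field mat, 'v) module"
  assumes "left_module (B_ring a lam) N"
  shows "vectorspace class_ring (restrict_scalars (diag_elem a) N)"
  by (rule vectorspace_restrict_scalars[OF assms class_field diag_elem_ring_hom])

lemma has_dimension_module_isomorphic:
  fixes M :: "(nat \<Rightarrow> nat \<Rightarrow> 'a::field mat, 'v) module" and N :: "(nat \<Rightarrow> nat \<Rightarrow> 'a mat, 'w) module"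
  assumes M: "left_module (B_ring a lam) M" and N: "left_module (B_ring a lam) N"
    and iso: "module_isomorphic (B_ring a lam) M N" and dim: "has_dimension a M d"
  shows "has_dimension a N d"
proof -
  obtain f where f: "f \<in> LinearCombinations.module_hom (B_ring a lam) M N"
      "bij_betw f (carrier M) (carrier N)"
    using iso by (auto simp: module_isomorphic_def)
  have "f \<in> LinearCombinations.module_hom class_ring (restrict_scalars (diag_elem a) M)
      (restrict_scalars (diag_elem a) N)"
    using f(1) diag_elem_B[of a _ lam] by (simp add: LinearCombinations.module_hom_def restrict_scalars_def)
  moreover have "bij_betw f (carrier (restrict_scalars (diag_elem a) M))
      (carrier (restrict_scalars (diag_elem a) N))"
    using f(2) by (simp add: restrict_scalars_def)
  ultimately show ?thesis
    using bij_linear_map_fin_dim_dim[OF vectorspace_restrict_diag[OF M] vectorspace_restrict_diag[OF N]] dim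
    by (simp add: has_dimension_def Let_def)
qed

text \<open>Closure under the generators is enough, by induction over the generated subring. The case of an
  additive inverse reduces to the scalar \<open>- 1\<close>.\<close>

lemma submodule_B_ringI:
  assumes N: "left_module (B_ring a lam) N"
    and H: "H \<subseteq> carrier N" "\<zero>\<^bsub>N\<^esub> \<in> H" "\<And>x y. x \<in> H \<Longrightarrow> y \<in> H \<Longrightarrow> x \<oplus>\<^bsub>N\<^esub> y \<in> H"
    and diag: "\<And>c x. x \<in> H \<Longrightarrow> diag_elem a c \<odot>\<^bsub>N\<^esub> x \<in> H"
    and e: "\<And>x. x \<in> H \<Longrightarrow> e_elem a lam \<odot>\<^bsub>N\<^esub> x \<in> H"
    and sigma: "\<And>x. x \<in> H \<Longrightarrow> sigma_elem a \<odot>\<^bsub>N\<^esub> x \<in> H"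
  shows "Module.submodule H (B_ring a lam) N"
proof (rule left_module.submoduleI[OF N H])
  interpret left_module "B_ring a lam" N by (rule N)
  interpret A: ring "A_ring a" by (rule ring_A_ring)
  fix b x
  assume "b \<in> carrier (B_ring a lam)"
  then have b: "b \<in> generate_ring (A_ring a) (range (diag_elem a) \<union> {e_elem a lam, sigma_elem a})"
    by (simp add: B_ring_def)
  then show "x \<in> H \<Longrightarrow> b \<odot>\<^bsub>N\<^esub> x \<in> H"
  proof (induct arbitrary: x)
    case one
    then show ?case using smult_one[of x] H(1) by auto
  next
    case (incl h)
    then show ?case using diag e sigma by auto
  next
    case (a_inv h)
    have h: "h \<in> carrier (B_ring a lam)" using a_inv(1) by (simp add: B_ring_def)
    note hA = B_carrier_subset_A[OF h]
    have "diag_elem a (- 1 :: 'a) \<oplus>\<^bsub>A_ring a\<^esub> \<one>\<^bsub>A_ring a\<^esub> = \<zero>\<^bsub>A_ring a\<^esub>"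
      using Ring.ring_hom_add[OF diag_elem_ring_hom[of a lam], of "- 1" 1] Ring.ring_hom_zero[OF diag_elem_ring_hom class_ring.ring_axioms ring_B_ring, of a lam]
      by (simp add: diag_elem_one)
    then have m1: "diag_elem a (- 1 :: 'a) = \<ominus>\<^bsub>A_ring a\<^esub> \<one>\<^bsub>A_ring a\<^esub>"
      using A.minus_equality[OF _ A_one_closed diag_elem_A] by metis
    have "\<ominus>\<^bsub>A_ring a\<^esub> h = diag_elem a (- 1) \<otimes>\<^bsub>A_ring a\<^esub> h"
      unfolding m1 using A.l_minus[OF A.one_closed hA] hA by simp
    then show ?case
      using a_inv diag[of "h \<odot>\<^bsub>N\<^esub> x" "- 1"] smult_assoc[OF diag_elem_B h, of x "- 1"] H(1) by auto
  next
    case (eng_add h1 h2)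
    then show ?case
      using smult_l_distr[of h1 h2 x] H by (auto simp: B_ring_def)
  next
    case (eng_mult h1 h2)
    then show ?case
      using smult_assoc[of h1 h2 x] H by (auto simp: B_ring_def)
  qed
qed

section \<open>The column modules\<close>

text \<open>Column vectors on which the algebra acts through its factor \<open>(n, i)\<close>.\<close>

definition column_module :: "nat \<Rightarrow> nat \<Rightarrow> (nat \<Rightarrow> nat \<Rightarrow> 'a::field mat, 'a vec) module" where
  "column_module n i = \<lparr>carrier = carrier_vec n, mult = undefined, one = undefined, zero = 0\<^sub>v n,
     add = (+), smult = (\<lambda>b v. b n i *\<^sub>v v)\<rparr>"

lemma column_module_simps [simp]:
  "carrier (column_module n i) = carrier_vec n" "\<zero>\<^bsub>column_module n i\<^esub> = 0\<^sub>v n"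
  "x \<oplus>\<^bsub>column_module n i\<^esub> y = x + y" "b \<odot>\<^bsub>column_module n i\<^esub> v = b n i *\<^sub>v v"
  by (simp_all add: column_module_def)

lemma left_module_column_module:
  assumes ni: "n \<in> supp a" "i \<in> {1..a n}"
  shows "left_module (B_ring a lam) (column_module n i)"
proof (intro left_module.intro left_module_axioms.intro ring_B_ring)
  show "abelian_group (column_module n i)"
    by (rule abelian_groupI) (auto intro!: bexI[of _ "- _"])
  note comp = A_component_carrier[OF B_carrier_subset_A ni]
  note [simp] = A_component[OF ni]
  fix b c :: "nat \<Rightarrow> nat \<Rightarrow> 'a mat" and x y :: "'a vec"
  assume b: "b \<in> carrier (B_ring a lam)"
  note bc = comp[OF b]
  show "x \<in> carrier (column_module n i) \<Longrightarrow> b \<odot>\<^bsub>column_module n i\<^esub> x \<in> carrier (column_module n i)"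
    using bc by auto
  show "x \<in> carrier (column_module n i) \<Longrightarrow> y \<in> carrier (column_module n i) \<Longrightarrow>
      b \<odot>\<^bsub>column_module n i\<^esub> (x \<oplus>\<^bsub>column_module n i\<^esub> y) =
      b \<odot>\<^bsub>column_module n i\<^esub> x \<oplus>\<^bsub>column_module n i\<^esub> b \<odot>\<^bsub>column_module n i\<^esub> y"
    using mult_add_distrib_mat_vec[OF bc] by auto
  assume c: "c \<in> carrier (B_ring a lam)"
  note cc = comp[OF c]
  show "x \<in> carrier (column_module n i) \<Longrightarrow>
      (b \<oplus>\<^bsub>B_ring a lam\<^esub> c) \<odot>\<^bsub>column_module n i\<^esub> x =
      b \<odot>\<^bsub>column_module n i\<^esub> x \<oplus>\<^bsub>column_module n i\<^esub> c \<odot>\<^bsub>column_module n i\<^esub> x"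
    using add_mult_distrib_mat_vec[OF bc cc] by auto
  show "x \<in> carrier (column_module n i) \<Longrightarrow>
      (b \<otimes>\<^bsub>B_ring a lam\<^esub> c) \<odot>\<^bsub>column_module n i\<^esub> x =
      b \<odot>\<^bsub>column_module n i\<^esub> (c \<odot>\<^bsub>column_module n i\<^esub> x)"
    using assoc_mult_mat_vec[OF bc cc] by auto
next
  fix x :: "'a vec" assume "x \<in> carrier (column_module n i)"
  then show "\<one>\<^bsub>B_ring a lam\<^esub> \<odot>\<^bsub>column_module n i\<^esub> x = x"
    by (simp add: A_component[OF ni])
qed

text \<open>Scalars act on column vectors as usual, so the identity map from the standard coordinate space is
  a linear isomorphism.\<close>

lemma has_dimension_column_module:
  assumes ni: "n \<in> supp a" "i \<in> {1..a n}"
  shows "has_dimension a (column_module n i :: (nat \<Rightarrow> nat \<Rightarrow> 'a::field mat, 'a vec) module) n"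
proof -
  let ?M = "column_module n i :: (nat \<Rightarrow> nat \<Rightarrow> 'a mat, 'a vec) module"
  let ?V = "restrict_scalars (diag_elem a) ?M"
  \<comment> \<open>The vector space does not depend on the weights, so any choice of them serves.\<close>
  have M: "left_module (B_ring a (\<lambda>_ _. 0)) ?M" by (rule left_module_column_module[OF ni])
  have "(c \<cdot>\<^sub>m 1\<^sub>m n) *\<^sub>v x = c \<cdot>\<^sub>v x" if x: "x \<in> carrier_vec n" for x :: "'a vec" and c
  proof (rule eq_vecI)
    fix r assume "r < dim_vec (c \<cdot>\<^sub>v x)"
    then have r: "r < n" using x by simp
    have "((c \<cdot>\<^sub>m 1\<^sub>m n) *\<^sub>v x) $ r = (\<Sum>s<n. c * (if s = r then 1 else 0) * x $ s)"
      using r x by (simp add: scalar_prod_def atLeast0LessThan)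
    also have "\<dots> = (\<Sum>s<n. if s = r then c * x $ s else 0)"
      using r by (intro sum.cong) auto
    also have "\<dots> = (c \<cdot>\<^sub>v x) $ r" using r x by simp
    finally show "((c \<cdot>\<^sub>m 1\<^sub>m n) *\<^sub>v x) $ r = (c \<cdot>\<^sub>v x) $ r" .
  qed (use x in simp)
  then have id: "id \<in> LinearCombinations.module_hom class_ring (module_vec TYPE('a) n) ?V"
    using ni by (auto simp: LinearCombinations.module_hom_def restrict_scalars_def module_vec_simps diag_elem_def)
  have bij: "bij_betw id (carrier (module_vec TYPE('a) n)) (carrier ?V)"
    by (simp add: restrict_scalars_def module_vec_simps)
  show ?thesis
    using bij_linear_map_fin_dim_dim[OF vec_vs vectorspace_restrict_diag[OF M] id bij vec_space.fin_dim]
      vec_space.dim_is_n[where ?'a = 'a, of n]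
    by (simp add: has_dimension_def Let_def)
qed

context separated_weights
begin

text \<open>A nonzero vector \<open>v\<close> with \<open>v\<^sub>k \<noteq> 0\<close> is sent to any vector \<open>x\<close> by the matrix whose \<open>k\<close>-th column is
  \<open>x / v\<^sub>k\<close>, and the algebra contains this matrix in the factor \<open>(n, i)\<close>.\<close>

lemma simple_column_module:
  assumes ni: "n \<in> supp a" "i \<in> {1..a n}"
  shows "simple_module B (column_module n i)"
proof -
  let ?M = "column_module n i :: (nat \<Rightarrow> nat \<Rightarrow> 'a mat, 'a vec) module"
  have n: "n > 0" using ni by (simp add: supp_def)
  have "unit_vec n 0 \<in> carrier ?M" by simp
  then have nontriv: "carrier ?M \<noteq> {\<zero>\<^bsub>?M\<^esub>}" using unit_vec_nonzero[OF n] by fastforce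
  have "H = {\<zero>\<^bsub>?M\<^esub>} \<or> H = carrier ?M" if H: "Module.submodule H B ?M" for H
  proof (cases "H = {\<zero>\<^bsub>?M\<^esub>}")
    case False
    interpret H: Module.submodule H B ?M by (rule H)
    note False
    moreover have "\<zero>\<^bsub>?M\<^esub> \<in> H" using H.one_closed by simp
    ultimately obtain v where v: "v \<in> H" "v \<noteq> 0\<^sub>v n" by auto
    have sub: "H \<subseteq> carrier_vec n" using H.subset by simp
    then have vc: "v \<in> carrier_vec n" using v by auto
    then obtain k where k: "k < n" "v $ k \<noteq> 0" using v(2) by (metis carrier_vecD eq_vecI index_zero_vec(1,2))
    have "x \<in> H" if x: "x \<in> carrier_vec n" for x
    proof -
      let ?X = "mat n n (\<lambda>(r, s). if s = k then x $ r / v $ k else 0)"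
      have "?X *\<^sub>v v = x"
      proof (rule eq_vecI)
        fix r assume "r < dim_vec x"
        then have r: "r < n" using x by simp
        have "(?X *\<^sub>v v) $ r = (\<Sum>s<n. ?X $$ (r, s) * v $ s)"
          using r vc by (simp add: scalar_prod_def atLeast0LessThan)
        also have "\<dots> = (\<Sum>s<n. if s = k then x $ r / v $ k * v $ s else 0)"
          using r by (intro sum.cong) auto
        also have "\<dots> = x $ r" using k by simp
        finally show "(?X *\<^sub>v v) $ r = x $ r" .
      qed (use x in auto)
      moreover have "single a n i ?X \<odot>\<^bsub>?M\<^esub> v \<in> H"
        by (rule H.smult_closed[OF single_B[OF ni] v(1)]) simp
      ultimately show ?thesis using ni by (simp add: single_component)
    qed
    then show ?thesis using sub by auto
  qed simp
  then show ?thesis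
    using left_module_column_module[OF ni] nontriv by (auto simp: simple_module_def)
qed

text \<open>The identity matrix in the factor \<open>(n, i)\<close> acts as the identity on one module and as zero on
  the other.\<close>

lemma column_module_not_isomorphic:
  assumes ni: "n \<in> supp a" "i \<in> {1..a n}" and mj: "m \<in> supp a" "j \<in> {1..a m}"
    and iso: "module_isomorphic B (column_module n i) (column_module m j)"
  shows "n = m \<and> i = j"
proof (rule ccontr)
  assume neq: "\<not> (n = m \<and> i = j)"
  let ?M = "column_module n i :: (nat \<Rightarrow> nat \<Rightarrow> 'a mat, 'a vec) module"
  let ?N = "column_module m j :: (nat \<Rightarrow> nat \<Rightarrow> 'a mat, 'a vec) module"
  have n: "n > 0" using ni by (simp add: supp_def)
  obtain f where f: "f \<in> LinearCombinations.module_hom B ?M ?N" "bij_betw f (carrier ?M) (carrier ?N)"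
    using iso by (auto simp: module_isomorphic_def)
  have fc: "f v \<in> carrier_vec m" if "v \<in> carrier_vec n" for v
    using f(2) that by (auto simp: bij_betw_def)
  let ?s = "single a n i (1\<^sub>m n)"
  have s: "?s \<in> carrier B" by (rule single_B[OF ni]) simp
  have "f v = 0\<^sub>v m" if v: "v \<in> carrier_vec n" for v
  proof -
    have "f (?s \<odot>\<^bsub>?M\<^esub> v) = ?s \<odot>\<^bsub>?N\<^esub> f v"
      using LinearCombinations.module_hom_smult[OF f(1) s] v by simp
    then have "f (1\<^sub>m n *\<^sub>v v) = 0\<^sub>m m m *\<^sub>v f v"
      using single_component[OF ni, of n i "1\<^sub>m n :: 'a mat"]
        single_component[OF mj, of n i "1\<^sub>m n :: 'a mat"] neq by auto
    moreover have "0\<^sub>m m m *\<^sub>v f v = 0\<^sub>v m"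
      using fc[OF v] by (intro eq_vecI) (auto simp: scalar_prod_def)
    ultimately show ?thesis using v by simp
  qed
  then have "f (unit_vec n 0) = f (0\<^sub>v n)" by simp
  then have "unit_vec n 0 = (0\<^sub>v n :: 'a vec)"
    using f(2) by (auto simp: bij_betw_def dest!: inj_onD)
  moreover have "unit_vec n 0 \<noteq> (0\<^sub>v n :: 'a vec)" by (rule unit_vec_nonzero[OF n])
  ultimately show False by contradiction
qed

end


section \<open>Simple modules of dimension greater than one\<close>

context separated_weights
begin

text \<open>For \<open>k > 0\<close> the element \<open>e \<sigma>\<^sup>k e\<close> is a finite sum of corners of single factors, one for each factor
  whose size divides \<open>k\<close>.\<close>

lemma e_sigma_pow_e_acts_trivially:
  assumes N: "left_module B N"
    and kill: "\<And>n i x v. n \<in> supp a \<Longrightarrow> i \<in> {1..a n} \<Longrightarrow> v \<in> carrier N \<Longrightarrow>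
      single a n i (mat_unit n 0 0 x) \<odot>\<^bsub>N\<^esub> v = \<zero>\<^bsub>N\<^esub>"
    and k: "k > 0" and v: "v \<in> carrier N"
  shows "(e_elem a lam \<otimes>\<^bsub>A_ring a\<^esub> sigma_pow a k \<otimes>\<^bsub>A_ring a\<^esub> e_elem a lam) \<odot>\<^bsub>N\<^esub> v = \<zero>\<^bsub>N\<^esub>"
proof -
  interpret left_module B N by (rule N)
  let ?P = "SIGMA m : {m \<in> supp a. m dvd k}. {1..a m}"
  let ?z = "\<lambda>C. e_elem a (\<lambda>m j. if (m, j) \<in> C then lam m j * lam m j else 0)"
  have z: "?z C \<in> carrier B \<and> ?z C \<odot>\<^bsub>N\<^esub> v = \<zero>\<^bsub>N\<^esub>" if "finite C" "C \<subseteq> ?P" for C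
    using that
  proof (induct C)
    case empty
    show ?case using v R.zero_closed smult_zero_left[OF v] by (simp add: e_elem_zero)
  next
    case (insert mj C)
    obtain m j where mj: "mj = (m, j)" "m \<in> supp a" "j \<in> {1..a m}" using insert by auto
    let ?s = "single a m j (mat_unit m 0 0 (lam m j * lam m j))"
    have s: "?s \<in> carrier B" by (rule single_corner_B[OF mj(2,3)])
    have "?z (insert mj C) = ?s \<oplus>\<^bsub>A_ring a\<^esub> ?z C"
      unfolding single_mat_unit_eq_e_elem e_elem_add
      by (rule arg_cong[where f = "e_elem a"], intro ext) (use insert(2) mj(1) in auto)
    then show ?case
      using insert s v kill[OF mj(2,3) v] smult_l_distr[of ?s "?z C" v] by (simp add: B_add_closed)
  qed
  moreover have "finite {m \<in> supp a. m dvd k}" using k by (simp add: finite_divisors_nat)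
  then have "finite ?P" by auto
  moreover have "e_elem a lam \<otimes>\<^bsub>A_ring a\<^esub> sigma_pow a k \<otimes>\<^bsub>A_ring a\<^esub> e_elem a lam = ?z ?P"
    unfolding e_sigma_pow_e by (rule e_elem_cong) auto
  ultimately show ?thesis using z[of ?P] by simp
qed

text \<open>Now \<open>e \<sigma>\<^sup>k e = 0\<close> on \<open>N\<close> for all \<open>k > 0\<close>. Then \<open>P = {v. e \<sigma>\<^sup>k v = 0 for all k}\<close> is a submodule. If it
  is all of \<open>N\<close>, then \<open>e\<close> acts as zero. Otherwise it vanishes, and since it contains \<open>\<sigma> e v\<close> for
  every \<open>v\<close>, also \<open>\<sigma> e = 0\<close> on \<open>N\<close>. This makes \<open>Q = {v. \<sigma> v = 0}\<close> a submodule: if \<open>Q\<close> is all of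
  \<open>N\<close>, then \<open>\<sigma>\<close> acts as zero, and if it vanishes, then so does its subset \<open>e N\<close>.\<close>

lemma e_or_sigma_acts_trivially:
  assumes simple: "simple_module B N"
    and kill: "\<And>n i x v. n \<in> supp a \<Longrightarrow> i \<in> {1..a n} \<Longrightarrow> v \<in> carrier N \<Longrightarrow>
      single a n i (mat_unit n 0 0 x) \<odot>\<^bsub>N\<^esub> v = \<zero>\<^bsub>N\<^esub>"
  shows "(\<forall>v\<in>carrier N. e_elem a lam \<odot>\<^bsub>N\<^esub> v = \<zero>\<^bsub>N\<^esub>) \<or>
    (\<forall>v\<in>carrier N. sigma_elem a \<odot>\<^bsub>N\<^esub> v = \<zero>\<^bsub>N\<^esub>)"
proof -
  have N: "left_module B N" by (rule simple_module_left_module[OF simple])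
  interpret left_module B N by (rule N)
  let ?e = "e_elem a lam" and ?s = "sigma_elem a"
  let ?c = "\<lambda>k. ?e \<otimes>\<^bsub>A_ring a\<^esub> sigma_pow a k"
  have e: "?e \<in> carrier B" and s: "?s \<in> carrier B" and d: "diag_elem a c \<in> carrier B"
    and c: "?c k \<in> carrier B" for c k
    by (simp_all add: B_closed)
  have diag_commute: "b \<odot>\<^bsub>N\<^esub> (diag_elem a x \<odot>\<^bsub>N\<^esub> v) = diag_elem a x \<odot>\<^bsub>N\<^esub> (b \<odot>\<^bsub>N\<^esub> v)"
    if "b \<in> carrier B" "v \<in> carrier N" for b x v
    using smult_assoc[OF that(1) d that(2), of x] smult_assoc[OF d that, of x]
      diag_elem_central[OF B_carrier_subset_A[OF that(1)], of x] by simp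
  have c0: "?c 0 = ?e"
    using monoid.r_one[OF ring.is_monoid[OF ring_A_ring] e_elem_A] by (simp add: sigma_pow_0)
  have cS: "?c k \<otimes>\<^bsub>A_ring a\<^esub> ?s = ?c (Suc k)" for k
    using monoid.m_assoc[OF ring.is_monoid[OF ring_A_ring] e_elem_A[of a lam] sigma_pow_A[of a k] sigma_pow_A[of a 1]]
      sigma_pow_add[of a k 1, where ?'a = 'a] unfolding sigma_pow_1 by simp
  have ce: "?c (Suc k) \<odot>\<^bsub>N\<^esub> (?e \<odot>\<^bsub>N\<^esub> v) = \<zero>\<^bsub>N\<^esub>" if "v \<in> carrier N" for k v
    using e_sigma_pow_e_acts_trivially[OF N kill _ that, of "Suc k"] smult_assoc[OF c e that, of "Suc k"]
    by simp
  let ?P = "{v \<in> carrier N. \<forall>k. ?c k \<odot>\<^bsub>N\<^esub> v = \<zero>\<^bsub>N\<^esub>}"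
  have "Module.submodule ?P B N"
  proof (rule submodule_B_ringI[OF N])
    fix v assume v: "v \<in> ?P"
    show "diag_elem a x \<odot>\<^bsub>N\<^esub> v \<in> ?P" for x
      using v c d by (auto simp: diag_commute smult_closed)
    have "?e \<odot>\<^bsub>N\<^esub> v = \<zero>\<^bsub>N\<^esub>" using v c0 by (metis (mono_tags, lifting) mem_Collect_eq)
    then show "?e \<odot>\<^bsub>N\<^esub> v \<in> ?P" using c by simp
    have "?c k \<odot>\<^bsub>N\<^esub> (?s \<odot>\<^bsub>N\<^esub> v) = \<zero>\<^bsub>N\<^esub>" for k
      using smult_assoc[OF c s, of v k] v cS[of k] by simp
    then show "?s \<odot>\<^bsub>N\<^esub> v \<in> ?P" using v s smult_closed by simp
  qed (use c in \<open>auto simp: smult_r_distr\<close>)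
  then consider "?P = {\<zero>\<^bsub>N\<^esub>}" | "?P = carrier N"
    using simple_moduleD[OF simple] by blast
  then show ?thesis
  proof cases
    case 2
    then have "?e \<odot>\<^bsub>N\<^esub> v = \<zero>\<^bsub>N\<^esub>" if "v \<in> carrier N" for v
      using that c0 by (metis (mono_tags, lifting) mem_Collect_eq)
    then show ?thesis by blast
  next
    case 1
    have se: "?s \<odot>\<^bsub>N\<^esub> (?e \<odot>\<^bsub>N\<^esub> v) = \<zero>\<^bsub>N\<^esub>" if v: "v \<in> carrier N" for v
    proof -
      have ev: "?e \<odot>\<^bsub>N\<^esub> v \<in> carrier N" by (rule smult_closed[OF e v])
      have "?c k \<odot>\<^bsub>N\<^esub> (?s \<odot>\<^bsub>N\<^esub> (?e \<odot>\<^bsub>N\<^esub> v)) = \<zero>\<^bsub>N\<^esub>" for k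
        using smult_assoc[OF c s ev, of k] cS[of k] ce[OF v] by simp
      then have "?s \<odot>\<^bsub>N\<^esub> (?e \<odot>\<^bsub>N\<^esub> v) \<in> ?P" using smult_closed[OF s ev] by simp
      then show ?thesis using 1 by blast
    qed
    let ?Q = "{v \<in> carrier N. ?s \<odot>\<^bsub>N\<^esub> v = \<zero>\<^bsub>N\<^esub>}"
    have "Module.submodule ?Q B N"
    proof (rule submodule_B_ringI[OF N])
      fix v assume v: "v \<in> ?Q"
      show "diag_elem a x \<odot>\<^bsub>N\<^esub> v \<in> ?Q" for x
        using v s d by (auto simp: diag_commute smult_closed)
    qed (use s e se in \<open>auto simp: smult_r_distr smult_closed\<close>)
    then consider "?Q = {\<zero>\<^bsub>N\<^esub>}" | "?Q = carrier N"
      using simple_moduleD[OF simple] by blast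
    then show ?thesis
    proof cases
      case 1
      then show ?thesis using se smult_closed[OF e] by blast
    qed blast
  qed
qed

end

text \<open>The line spanned by the common eigenvector is closed under the generators and scalars, hence a
  submodule, hence everything.\<close>

lemma dim_le_1_if_common_eigenvector:
  fixes N :: "(nat \<Rightarrow> nat \<Rightarrow> 'a::field mat, 'v) module"
  assumes simple: "simple_module (B_ring a lam) N" and u: "u \<in> carrier N" "u \<noteq> \<zero>\<^bsub>N\<^esub>"
    and e: "e_elem a lam \<odot>\<^bsub>N\<^esub> u = diag_elem a x \<odot>\<^bsub>N\<^esub> u"
    and s: "sigma_elem a \<odot>\<^bsub>N\<^esub> u = diag_elem a y \<odot>\<^bsub>N\<^esub> u"
    and dim: "has_dimension a N d"
  shows "d \<le> 1"
proof -
  have N: "left_module (B_ring a lam) N" by (rule simple_module_left_module[OF simple])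
  interpret left_module "B_ring a lam" N by (rule N)
  let ?V = "restrict_scalars (diag_elem a) N"
  interpret V: vectorspace class_ring ?V by (rule vectorspace_restrict_diag[OF N])
  have V_simps: "carrier ?V = carrier N" "\<zero>\<^bsub>?V\<^esub> = \<zero>\<^bsub>N\<^esub>" "add ?V = add N"
    "c \<odot>\<^bsub>?V\<^esub> v = diag_elem a c \<odot>\<^bsub>N\<^esub> v" for c v
    by (simp_all add: restrict_scalars_def)
  have d: "diag_elem a c \<in> carrier (B_ring a lam)" for c by (rule diag_elem_B)
  let ?H = "{diag_elem a c \<odot>\<^bsub>N\<^esub> u | c. True}"
  have mult: "diag_elem a c \<odot>\<^bsub>N\<^esub> (diag_elem a c' \<odot>\<^bsub>N\<^esub> u) = diag_elem a (c * c') \<odot>\<^bsub>N\<^esub> u" for c c'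
    using V.smult_assoc1[of c c' u] u by (simp add: V_simps)
  have gen: "b \<odot>\<^bsub>N\<^esub> (diag_elem a c \<odot>\<^bsub>N\<^esub> u) = diag_elem a (c * z) \<odot>\<^bsub>N\<^esub> u"
    if b: "b \<in> carrier (B_ring a lam)" "b \<odot>\<^bsub>N\<^esub> u = diag_elem a z \<odot>\<^bsub>N\<^esub> u" for b c z
    using smult_assoc[OF b(1) d u(1), of c] smult_assoc[OF d b(1) u(1), of c] b(2) mult[of c z]
      diag_elem_central[OF B_carrier_subset_A[OF b(1)], of c] by simp
  have "Module.submodule ?H (B_ring a lam) N"
  proof (rule submodule_B_ringI[OF N])
    show "?H \<subseteq> carrier N" using smult_closed[OF d u(1)] by auto
    have "diag_elem a 0 \<odot>\<^bsub>N\<^esub> u = \<zero>\<^bsub>N\<^esub>"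
      using V.lmult_0[of u] u by (simp add: V_simps)
    then have "\<zero>\<^bsub>N\<^esub> = diag_elem a 0 \<odot>\<^bsub>N\<^esub> u" by simp
    then show "\<zero>\<^bsub>N\<^esub> \<in> ?H" by blast
  next
    fix v w assume "v \<in> ?H" "w \<in> ?H"
    then obtain c c' where "v = diag_elem a c \<odot>\<^bsub>N\<^esub> u" "w = diag_elem a c' \<odot>\<^bsub>N\<^esub> u" by auto
    then have "v \<oplus>\<^bsub>N\<^esub> w = diag_elem a (c + c') \<odot>\<^bsub>N\<^esub> u"
      using V.smult_l_distr[of c c' u] u by (simp add: V_simps)
    then show "v \<oplus>\<^bsub>N\<^esub> w \<in> ?H" by blast
  next
    fix v assume "v \<in> ?H"
    then obtain c where v: "v = diag_elem a c \<odot>\<^bsub>N\<^esub> u" by auto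
    show "diag_elem a c' \<odot>\<^bsub>N\<^esub> v \<in> ?H" for c' unfolding v mult by blast
    show "e_elem a lam \<odot>\<^bsub>N\<^esub> v \<in> ?H" unfolding v gen[OF e_elem_B e] by blast
    show "sigma_elem a \<odot>\<^bsub>N\<^esub> v \<in> ?H" unfolding v gen[OF sigma_elem_B s] by blast
  qed
  moreover have "u = diag_elem a 1 \<odot>\<^bsub>N\<^esub> u" using V.smult_one[of u] u by (simp add: V_simps)
  then have "u \<in> ?H" by blast
  ultimately have H: "?H = carrier N"
    using simple_moduleD[OF simple] u(2) by blast
  have "V.span {u} = carrier ?V"
  proof (rule equalityI)
    show "V.span {u} \<subseteq> carrier ?V"
      using V.span_is_subset2[of "{u}"] u by (simp add: V_simps)
    have "diag_elem a c \<odot>\<^bsub>N\<^esub> u \<in> V.span {u}" for c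
    proof -
      have "V.lincomb (\<lambda>_. c) {u} = diag_elem a c \<odot>\<^bsub>N\<^esub> u"
        using u smult_closed[OF d u(1)] by (simp add: V.lincomb_def V_simps)
      moreover have "V.lincomb (\<lambda>_. c) {u} \<in> V.span {u}"
        unfolding V.span_def by (intro CollectI exI[of _ "\<lambda>_. c"] exI[of _ "{u}"]) simp
      ultimately show ?thesis by simp
    qed
    then have "?H \<subseteq> V.span {u}" by blast
    then show "carrier ?V \<subseteq> V.span {u}" using H by (simp only: V_simps)
  qed
  then have "V.dim \<le> 1" by (rule V.dim_le1I) (use u in \<open>simp add: V_simps\<close>)
  then show ?thesis using dim by (simp add: has_dimension_def Let_def)
qed

context separated_weights
begin

text \<open>Letting a column vector \<open>v\<close> stand for the element with first column \<open>v\<close> in the factor \<open>(n, i)\<close> identifies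
  the column module with a left ideal of the algebra. Applying that ideal to \<open>w\<close> is a homomorphism
  to \<open>N\<close>, nonzero by the choice of \<open>w\<close>, and Schur's lemma applies.\<close>

lemma simple_module_isomorphic_column_module:
  assumes simple: "simple_module B N"
    and ni: "n \<in> supp a" "i \<in> {1..a n}"
    and w: "w \<in> carrier N" "single a n i (mat_unit n 0 0 x) \<odot>\<^bsub>N\<^esub> w \<noteq> \<zero>\<^bsub>N\<^esub>"
  shows "module_isomorphic B N (column_module n i)"
proof -
  have N: "left_module B N" by (rule simple_module_left_module[OF simple])
  interpret left_module B N by (rule N)
  have n: "n > 0" using ni by (simp add: supp_def)
  let ?X = "\<lambda>v. mat n n (\<lambda>(r, s). if s = 0 then v $ r else 0) :: 'a mat"
  define f where "f v = single a n i (?X v) \<odot>\<^bsub>N\<^esub> w" for v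
  have L: "single a n i (?X v) \<in> carrier B" for v by (rule single_B[OF ni]) simp
  have "f \<in> LinearCombinations.module_hom B (column_module n i) N"
    unfolding LinearCombinations.module_hom_def
  proof (intro CollectI conjI allI impI funcsetI)
    fix v show "f v \<in> carrier N" unfolding f_def by (rule smult_closed[OF L w(1)])
  next
    fix v v' :: "'a vec" assume v: "v \<in> carrier (column_module n i) \<and> v' \<in> carrier (column_module n i)"
    have "?X (v + v') = ?X v + ?X v'" using v by (auto intro!: eq_matI)
    then have "single a n i (?X (v + v')) = single a n i (?X v) \<oplus>\<^bsub>A_ring a\<^esub> single a n i (?X v')"
      by (simp add: single_add)
    then show "f (v \<oplus>\<^bsub>column_module n i\<^esub> v') = f v \<oplus>\<^bsub>N\<^esub> f v'"
      using smult_l_distr[OF L L w(1)] by (simp add: f_def)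
  next
    fix b and v :: "'a vec" assume bv: "b \<in> carrier B \<and> v \<in> carrier (column_module n i)"
    then have b: "b \<in> carrier B" and v: "v \<in> carrier_vec n" by auto
    have X: "?X v \<in> carrier_mat n n" by simp
    note bA = B_carrier_subset_A[OF b]
    note bn = A_component_carrier[OF bA ni]
    have "b n i * ?X v = ?X (b n i *\<^sub>v v)"
    proof (rule eq_matI)
      fix r s assume "r < dim_row (?X (b n i *\<^sub>v v))" "s < dim_col (?X (b n i *\<^sub>v v))"
      then have rs: "r < n" "s < n" by auto
      have "(b n i * ?X v) $$ (r, s) = (\<Sum>k<n. b n i $$ (r, k) * ?X v $$ (k, s))"
        by (rule index_mult_mat_sum[OF bn X rs])
      also have "\<dots> = (\<Sum>k<n. if s = 0 then b n i $$ (r, k) * v $ k else 0)"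
        using rs by (intro sum.cong) auto
      also have "\<dots> = ?X (b n i *\<^sub>v v) $$ (r, s)"
        using rs bn v by (simp add: scalar_prod_def atLeast0LessThan)
      finally show "(b n i * ?X v) $$ (r, s) = ?X (b n i *\<^sub>v v) $$ (r, s)" .
    qed (use bn in auto)
    then have "b \<otimes>\<^bsub>A_ring a\<^esub> single a n i (?X v) = single a n i (?X (b n i *\<^sub>v v))"
      using A_mult_single[OF X ni bA] by simp
    then show "f (b \<odot>\<^bsub>column_module n i\<^esub> v) = b \<odot>\<^bsub>N\<^esub> f v"
      using smult_assoc[OF b L w(1), of v] by (simp add: f_def)
  qed
  moreover have "?X (x \<cdot>\<^sub>v unit_vec n 0) = mat_unit n 0 0 x"
    using n by (auto intro!: eq_matI)
  then have "f (x \<cdot>\<^sub>v unit_vec n 0) \<noteq> \<zero>\<^bsub>N\<^esub>" using w(2) by (simp add: f_def)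
  then have "\<exists>v\<in>carrier (column_module n i). f v \<noteq> \<zero>\<^bsub>N\<^esub>"
    by (intro bexI[of _ "x \<cdot>\<^sub>v unit_vec n 0"]) auto
  ultimately have "module_isomorphic B (column_module n i) N"
    using nonzero_hom_between_simple_modules_bij[OF simple_column_module[OF ni] simple]
    by (auto simp: module_isomorphic_def)
  then show ?thesis by (rule module_isomorphic_sym[OF left_module_column_module[OF ni]])
qed

end

text \<open>Scalars are central in \<open>B\<close>, so every element acts linearly over the ground field.\<close>

lemma linear_operator_smult:
  fixes N :: "(nat \<Rightarrow> nat \<Rightarrow> 'a::field mat, 'v) module"
  assumes N: "left_module (B_ring a lam) N" and b: "b \<in> carrier (B_ring a lam)"
  shows "linear_operator (restrict_scalars (diag_elem a) N) (\<lambda>v. b \<odot>\<^bsub>N\<^esub> v)"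
proof -
  interpret left_module "B_ring a lam" N by (rule N)
  have "b \<odot>\<^bsub>N\<^esub> (diag_elem a c \<odot>\<^bsub>N\<^esub> v) = diag_elem a c \<odot>\<^bsub>N\<^esub> (b \<odot>\<^bsub>N\<^esub> v)" if "v \<in> carrier N" for c v
    using smult_assoc[OF b diag_elem_B that, of c] smult_assoc[OF diag_elem_B b that, of c]
      diag_elem_central[OF B_carrier_subset_A[OF b], of c] by simp
  then show ?thesis
    using b by (intro linear_operator.intro vectorspace_restrict_diag[OF N] linear_operator_axioms.intro)
      (auto simp: restrict_scalars_def smult_closed smult_r_distr)
qed

text \<open>If the corners of all factors annihilated \<open>N\<close>, then one of \<open>e\<close>, \<open>\<sigma>\<close> would act as zero, an
  eigenvector of the other would span a submodule, and \<open>N\<close> would be a line. So some factor acts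
  nontrivially, which identifies \<open>N\<close> with its column module and the dimension with its size.\<close>

lemma simple_module_of_dim_gt_1:
  fixes a :: "nat \<Rightarrow> nat" and lam :: "nat \<Rightarrow> nat \<Rightarrow> 'a::alg_closed_field"
    and N :: "(nat \<Rightarrow> nat \<Rightarrow> 'a mat, 'v) module"
  assumes "separated_weights a lam"
    and simple: "simple_module (B_ring a lam) N" and dim: "has_dimension a N d" "d > 1"
  shows "d \<in> supp a \<and> (\<exists>i\<in>{1..a d}. module_isomorphic (B_ring a lam) N (column_module d i))"
proof -
  interpret separated_weights a lam by fact
  have N: "left_module B N" by (rule simple_module_left_module[OF simple])
  interpret left_module B N by (rule N)
  have "\<exists>n i x w. n \<in> supp a \<and> i \<in> {1..a n} \<and> w \<in> carrier N \<and>
    single a n i (mat_unit n 0 0 x) \<odot>\<^bsub>N\<^esub> w \<noteq> \<zero>\<^bsub>N\<^esub>"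
  proof (rule ccontr)
    assume "\<not> ?thesis"
    then have trivial: "(\<forall>v\<in>carrier N. e_elem a lam \<odot>\<^bsub>N\<^esub> v = \<zero>\<^bsub>N\<^esub>) \<or>
        (\<forall>v\<in>carrier N. sigma_elem a \<odot>\<^bsub>N\<^esub> v = \<zero>\<^bsub>N\<^esub>)"
      by (intro e_or_sigma_acts_trivially[OF simple]) blast
    let ?V = "restrict_scalars (diag_elem a) N"
    have "vectorspace.fin_dim class_ring ?V" "carrier ?V \<noteq> {\<zero>\<^bsub>?V\<^esub>}"
      using dim simple by (auto simp: has_dimension_def Let_def simple_module_def restrict_scalars_def)
    then have eigen: "\<exists>u\<in>carrier N. u \<noteq> \<zero>\<^bsub>N\<^esub> \<and> (\<exists>c. b \<odot>\<^bsub>N\<^esub> u = diag_elem a c \<odot>\<^bsub>N\<^esub> u)"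
      if "b \<in> carrier B" for b
      using eigenvector_exists[OF linear_operator_smult[OF N that]] by (simp add: restrict_scalars_def)
    have zero: "diag_elem a 0 \<odot>\<^bsub>N\<^esub> u = \<zero>\<^bsub>N\<^esub>" if "u \<in> carrier N" for u
      using linear_operator.scalar_zero[OF linear_operator_smult[OF N e_elem_B], of u] that
      by (simp add: restrict_scalars_def)
    from trivial show False
    proof
      assume "\<forall>v\<in>carrier N. e_elem a lam \<odot>\<^bsub>N\<^esub> v = \<zero>\<^bsub>N\<^esub>"
      then show False
        using eigen[OF sigma_elem_B] dim_le_1_if_common_eigenvector[OF simple _ _ _ _ dim(1), of _ 0] zero dim(2)
        by fastforce
    next
      assume "\<forall>v\<in>carrier N. sigma_elem a \<odot>\<^bsub>N\<^esub> v = \<zero>\<^bsub>N\<^esub>"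
      then show False
        using eigen[OF e_elem_B] dim_le_1_if_common_eigenvector[OF simple _ _ _ _ dim(1), of _ _ 0] zero dim(2)
        by fastforce
    qed
  qed
  then obtain n i where ni: "n \<in> supp a" "i \<in> {1..a n}"
      and iso: "module_isomorphic B N (column_module n i)"
    using simple_module_isomorphic_column_module[OF simple] by blast
  have "has_dimension a (column_module n i :: (nat \<Rightarrow> nat \<Rightarrow> 'a mat, 'a vec) module) d"
    by (rule has_dimension_module_isomorphic[OF N left_module_column_module[OF ni] iso dim(1)])
  then have "d = n"
    using has_dimension_column_module[OF ni, where ?'a = 'a] by (simp add: has_dimension_def Let_def)
  then show ?thesis using ni iso by blast
qed

theorem proposition2p3:
  fixes a :: "nat \<Rightarrow> nat"
    and lam :: "nat \<Rightarrow> nat \<Rightarrow> 'a :: alg_closed_field"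
  assumes lam_nonzero: "\<And>n i. n \<in> supp a \<Longrightarrow> i \<in> {1..a n} \<Longrightarrow> lam n i \<noteq> 0"
    and lam_distinct: "inj_on (\<lambda>(n, i). lam n i) (SIGMA n : supp a. {1..a n})"
    and lam_distinct_sign: "\<And>n i j. n \<in> supp a \<Longrightarrow> i \<in> {1..a n} \<Longrightarrow> j \<in> {1..a n} \<Longrightarrow> i \<noteq> j \<Longrightarrow>
      lam n i \<noteq> lam n j \<and> lam n i \<noteq> - lam n j"
  shows "(\<forall>n\<in>supp a. \<exists>Ms :: (nat \<Rightarrow> nat \<Rightarrow> 'a mat, 'a vec) module set.
            finite Ms \<and> card Ms = a n \<and>
            (\<forall>M\<in>Ms. simple_module (B_ring a lam) M \<and> has_dimension a M n) \<and>
            (\<forall>M\<in>Ms. \<forall>M'\<in>Ms. M \<noteq> M' \<longrightarrow> \<not> module_isomorphic (B_ring a lam) M M') \<and>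
            (\<forall>N :: (nat \<Rightarrow> nat \<Rightarrow> 'a mat, 'v) module.
               simple_module (B_ring a lam) N \<and> has_dimension a N n \<longrightarrow>
               (\<exists>M\<in>Ms. module_isomorphic (B_ring a lam) N M))) \<and>
         (\<forall>n>1. n \<notin> supp a \<longrightarrow>
            \<not> (\<exists>N :: (nat \<Rightarrow> nat \<Rightarrow> 'a mat, 'v) module.
                  simple_module (B_ring a lam) N \<and> has_dimension a N n))"
proof (intro conjI ballI)
  interpret separated_weights a lam using lam_nonzero lam_distinct by unfold_locales
  note classify = simple_module_of_dim_gt_1[OF separated_weights_axioms]
  show "\<forall>n>1. n \<notin> supp a \<longrightarrow>
      \<not> (\<exists>N :: (nat \<Rightarrow> nat \<Rightarrow> 'a mat, 'v) module. simple_module B N \<and> has_dimension a N n)"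
    using classify by blast
  fix n assume n: "n \<in> supp a"
  let ?Ms = "column_module n ` {1..a n} :: (nat \<Rightarrow> nat \<Rightarrow> 'a mat, 'a vec) module set"
  have refl: "module_isomorphic B M M" for M :: "(nat \<Rightarrow> nat \<Rightarrow> 'a mat, 'a vec) module"
    unfolding module_isomorphic_def
    by (rule bexI[of _ id]) (auto simp: LinearCombinations.module_hom_def)
  have noniso: "i = j" if "i \<in> {1..a n}" "j \<in> {1..a n}"
      "module_isomorphic B (column_module n i) (column_module n j)" for i j
    using column_module_not_isomorphic[OF n that(1) n that(2,3)] by simp
  have "inj_on (column_module n :: _ \<Rightarrow> (nat \<Rightarrow> nat \<Rightarrow> 'a mat, 'a vec) module) {1..a n}"
  proof (rule inj_onI)
    fix i j assume ij: "i \<in> {1..a n}" "j \<in> {1..a n}"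
      "column_module n i = (column_module n j :: (nat \<Rightarrow> nat \<Rightarrow> 'a mat, 'a vec) module)"
    show "i = j" using noniso[OF ij(1,2)] refl[of "column_module n i"] unfolding ij(3) by blast
  qed
  then have "card ?Ms = a n" by (simp add: card_image)
  moreover have "\<forall>N :: (nat \<Rightarrow> nat \<Rightarrow> 'a mat, 'v) module. simple_module B N \<and> has_dimension a N n \<longrightarrow>
      (\<exists>M\<in>?Ms. module_isomorphic B N M)"
    using classify[of _ n] n by (auto simp: supp_def)
  ultimately show "\<exists>Ms :: (nat \<Rightarrow> nat \<Rightarrow> 'a mat, 'a vec) module set.
      finite Ms \<and> card Ms = a n \<and>
      (\<forall>M\<in>Ms. simple_module B M \<and> has_dimension a M n) \<and>
      (\<forall>M\<in>Ms. \<forall>M'\<in>Ms. M \<noteq> M' \<longrightarrow> \<not> module_isomorphic B M M') \<and>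
      (\<forall>N :: (nat \<Rightarrow> nat \<Rightarrow> 'a mat, 'v) module. simple_module B N \<and> has_dimension a N n \<longrightarrow>
         (\<exists>M\<in>Ms. module_isomorphic B N M))"
    using simple_column_module[OF n] has_dimension_column_module[OF n, where ?'a = 'a] noniso
    by (intro exI[of _ ?Ms] conjI) blast+
qed

end
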